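(* Let $K$ be a field whose characteristic does not divide $24$. Assume that $K$ has an element of multiplicative order $24$ or $\mathrm{char}(K)\neq 5$. Then the symmetric group $\mathrm{S}_4$ of degree $4$ satisfies $\beta_{\mathrm{sep}}^K(\mathrm{S}_4)=9$.
   Context: Let $K$ be a field and $G$ a finite group with $\mathrm{char}(K)\nmid |G|$. For a finite dimensional $KG$-module $V$, $K[V]$ is the polynomial ring in the coordinate functions on $V$, on which $G$ acts by $(g\cdot f)(v)=f(g^{-1}v)$, and $K[V]^G$ is the subalgebra of $G$-invariants. A subset $S\subseteq K[V]^G$ is a separating set if whenever $v,w\in V$ have different $G$-orbits, there is $f\in S$ with $f(v)\ne f(w)$. The number $\beta_{\mathrm{sep}}(G,V)$ is the minimal positive integer $d$ such that the elements of $K[V]^G$ of degree at most $d$ form a separating set, and $\beta_{\mathrm{sep}}^K(G)$ is the supremum of $\beta_{\mathrm{sep}}(G,V)$ over all finite dimensional $KG$-modules $V$. *)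

theory Defs
  imports
    "Jordan_Normal_Form.Matrix"
    "HOL-Algebra.Sym_Groups"
    "HOL-Computational_Algebra.Computational_Algebra"
    "HOL-Library.Poly_Mapping"
    "HOL-Library.Extended_Nat"
begin

section \<open>Multivariate polynomials\<close>

text \<open>
  A polynomial in the variables \<open>x\<^sub>0, x\<^sub>1, \<dots>\<close> is a finitely supported map from monomials
  to coefficients; a monomial is a finitely supported map from variable indices to exponents.
  These are formal polynomials: over a finite field they are not identified with the functions
  that they induce.
\<close>

type_synonym 'k mpoly = "(nat \<Rightarrow>\<^sub>0 nat) \<Rightarrow>\<^sub>0 'k"

definition mpoly_var :: "nat \<Rightarrow> 'k::field mpoly" where
  "mpoly_var i = Poly_Mapping.single (Poly_Mapping.single i 1) 1"

definition mpoly_const :: "'k \<Rightarrow> 'k::field mpoly" where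
  "mpoly_const c = Poly_Mapping.single 0 c"

definition mpoly_carrier :: "nat \<Rightarrow> 'k::field mpoly set" where
  "mpoly_carrier n = {f. \<forall>m \<in> Poly_Mapping.keys f. Poly_Mapping.keys m \<subseteq> {..<n}}"

definition monom_degree :: "(nat \<Rightarrow>\<^sub>0 nat) \<Rightarrow> nat" where
  "monom_degree m = (\<Sum>i \<in> Poly_Mapping.keys m. Poly_Mapping.lookup m i)"

text \<open>The total degree, with the convention that the zero polynomial has degree \<open>0\<close>.\<close>

definition total_degree :: "'k::field mpoly \<Rightarrow> nat" where
  "total_degree f = Max (insert 0 (monom_degree ` Poly_Mapping.keys f))"

text \<open>
  The image of \<open>f\<close> when the coefficients are mapped by \<open>h\<close> and the variable \<open>x\<^sub>i\<close> is
  replaced by \<open>s i\<close>.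
\<close>

definition mpoly_insert ::
  "('k \<Rightarrow> 'a) \<Rightarrow> (nat \<Rightarrow> 'a) \<Rightarrow> 'k::field mpoly \<Rightarrow> 'a::comm_ring_1" where
  "mpoly_insert h s f =
     (\<Sum>m \<in> Poly_Mapping.keys f.
        h (Poly_Mapping.lookup f m) *
        (\<Prod>i \<in> Poly_Mapping.keys m. s i ^ Poly_Mapping.lookup m i))"

definition mpoly_eval :: "'k::field mpoly \<Rightarrow> 'k vec \<Rightarrow> 'k" where
  "mpoly_eval f v = mpoly_insert (\<lambda>c. c) (\<lambda>i. v $ i) f"

definition mpoly_subst :: "(nat \<Rightarrow> 'k mpoly) \<Rightarrow> 'k::field mpoly \<Rightarrow> 'k mpoly" where
  "mpoly_subst s f = mpoly_insert mpoly_const s f"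


section \<open>Modules, invariants and separating sets\<close>

text \<open>
  After the choice of a basis, a \<open>KG\<close>-module of dimension \<open>n\<close> is \<open>K\<^sup>n\<close> with \<open>G\<close> acting
  through matrices, \<open>g \<cdot> v = \<rho> g *\<^sub>v v\<close>. Nothing below depends on the choice of the basis.
\<close>

definition KG_module :: "('g, 'b) monoid_scheme \<Rightarrow> nat \<Rightarrow> ('g \<Rightarrow> 'k::field mat) \<Rightarrow> bool" where
  "KG_module G n \<rho> \<longleftrightarrow>
     (\<forall>g \<in> carrier G. \<rho> g \<in> carrier_mat n n) \<and>
     \<rho> \<one>\<^bsub>G\<^esub> = 1\<^sub>m n \<and>
     (\<forall>g \<in> carrier G. \<forall>h \<in> carrier G. \<rho> (g \<otimes>\<^bsub>G\<^esub> h) = \<rho> g * \<rho> h)"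

definition KG_orbit :: "('g, 'b) monoid_scheme \<Rightarrow> ('g \<Rightarrow> 'k::field mat) \<Rightarrow> 'k vec \<Rightarrow> 'k vec set" where
  "KG_orbit G \<rho> v = {\<rho> g *\<^sub>v v | g. g \<in> carrier G}"

text \<open>
  \<open>x\<^sub>i\<close> is the \<open>i\<close>-th coordinate function, so \<open>g \<cdot> x\<^sub>i\<close> is the \<open>i\<close>-th coordinate of
  \<open>g\<^sup>-\<^sup>1 v\<close>, a linear form in \<open>v\<close>, and \<open>g\<close> acts on polynomials by algebra homomorphisms.
  The lemma \<open>mpoly_eval_KG_act\<close> below is the resulting formula
  \<open>(g \<cdot> f)(v) = f (g\<^sup>-\<^sup>1 v)\<close>.
\<close>

definition KG_act ::
  "('g, 'b) monoid_scheme \<Rightarrow> nat \<Rightarrow> ('g \<Rightarrow> 'k::field mat) \<Rightarrow> 'g \<Rightarrow> 'k mpoly \<Rightarrow> 'k mpoly" where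
  "KG_act G n \<rho> g f =
     mpoly_subst (\<lambda>i. \<Sum>j<n. mpoly_const (\<rho> (inv\<^bsub>G\<^esub> g) $$ (i, j)) * mpoly_var j) f"

definition KG_invariants ::
  "('g, 'b) monoid_scheme \<Rightarrow> nat \<Rightarrow> ('g \<Rightarrow> 'k::field mat) \<Rightarrow> 'k mpoly set" where
  "KG_invariants G n \<rho> =
     {f \<in> mpoly_carrier n. \<forall>g \<in> carrier G. KG_act G n \<rho> g f = f}"

definition separating_set ::
  "('g, 'b) monoid_scheme \<Rightarrow> nat \<Rightarrow> ('g \<Rightarrow> 'k::field mat) \<Rightarrow> 'k mpoly set \<Rightarrow> bool" where
  "separating_set G n \<rho> S \<longleftrightarrow>
     S \<subseteq> KG_invariants G n \<rho> \<and>
     (\<forall>v \<in> carrier_vec n. \<forall>w \<in> carrier_vec n.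
        KG_orbit G \<rho> v \<noteq> KG_orbit G \<rho> w \<longrightarrow> (\<exists>f \<in> S. mpoly_eval f v \<noteq> mpoly_eval f w))"

text \<open>
  The minimum is taken in \<^typ>\<open>enat\<close>, so that it would be \<open>\<infinity>\<close>, and not some arbitrary
  number, if no \<open>d\<close> qualified.
\<close>

definition beta_sep_module ::
  "('g, 'b) monoid_scheme \<Rightarrow> nat \<Rightarrow> ('g \<Rightarrow> 'k::field mat) \<Rightarrow> enat" where
  "beta_sep_module G n \<rho> =
     Inf {enat d | d. d > 0 \<and> separating_set G n \<rho> {f \<in> KG_invariants G n \<rho>. total_degree f \<le> d}}"

definition beta_sep :: "'k::field itself \<Rightarrow> ('g, 'b) monoid_scheme \<Rightarrow> enat" where
  "beta_sep K G =
     Sup {beta_sep_module G n \<rho> | n (\<rho> :: 'g \<Rightarrow> 'k mat). KG_module G n \<rho>}"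

definition has_mult_order :: "'k::field \<Rightarrow> nat \<Rightarrow> bool" where
  "has_mult_order x n \<longleftrightarrow> n > 0 \<and> x ^ n = 1 \<and> (\<forall>m. 0 < m \<and> m < n \<longrightarrow> x ^ m \<noteq> 1)"


section \<open>The action on polynomials as functions\<close>

lemma mpoly_insert_superset:
  assumes "finite A" "Poly_Mapping.keys f \<subseteq> A" "h 0 = 0"
  shows "mpoly_insert h s f =
     (\<Sum>m \<in> A. h (Poly_Mapping.lookup f m) *
        (\<Prod>i \<in> Poly_Mapping.keys m. s i ^ Poly_Mapping.lookup m i))"
  unfolding mpoly_insert_def
  by (rule sum.mono_neutral_left) (use assms in \<open>auto simp: in_keys_iff\<close>)

lemma mpoly_eval_add: "mpoly_eval (f + g) v = mpoly_eval f v + mpoly_eval g v"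
proof -
  let ?A = "Poly_Mapping.keys f \<union> Poly_Mapping.keys g"
  have "Poly_Mapping.keys (f + g) \<subseteq> ?A"
    by (rule Poly_Mapping.keys_add)
  then show ?thesis
    unfolding mpoly_eval_def
    by (simp add: mpoly_insert_superset[of ?A] lookup_add distrib_right sum.distrib)
qed

lemma mpoly_eval_zero [simp]: "mpoly_eval 0 v = 0"
  by (simp add: mpoly_eval_def mpoly_insert_def)

lemma mpoly_eval_sum: "mpoly_eval (\<Sum>x \<in> A. F x) v = (\<Sum>x \<in> A. mpoly_eval (F x) v)"
  by (induction A rule: infinite_finite_induct) (simp_all add: mpoly_eval_add)

lemma mpoly_eval_single:
  "mpoly_eval (Poly_Mapping.single m c) v =
     c * (\<Prod>i \<in> Poly_Mapping.keys m. (v $ i) ^ Poly_Mapping.lookup m i)"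
  by (simp add: mpoly_eval_def mpoly_insert_def lookup_single)

lemma monom_eval_add:
  fixes s :: "nat \<Rightarrow> 'a::comm_ring_1"
  shows "(\<Prod>i \<in> Poly_Mapping.keys (m + m'). s i ^ Poly_Mapping.lookup (m + m') i) =
     (\<Prod>i \<in> Poly_Mapping.keys m. s i ^ Poly_Mapping.lookup m i) *
     (\<Prod>i \<in> Poly_Mapping.keys m'. s i ^ Poly_Mapping.lookup m' i)"
proof -
  let ?A = "Poly_Mapping.keys m \<union> Poly_Mapping.keys m'"
  have *: "(\<Prod>i \<in> Poly_Mapping.keys q. s i ^ Poly_Mapping.lookup q i) =
      (\<Prod>i \<in> ?A. s i ^ Poly_Mapping.lookup q i)" if "Poly_Mapping.keys q \<subseteq> ?A" for q
    by (rule prod.mono_neutral_left) (use that in \<open>auto simp: in_keys_iff\<close>)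
  show ?thesis
    using *[OF Poly_Mapping.keys_add] *[of m] *[of m']
    by (simp add: lookup_add power_add prod.distrib)
qed

lemma mpoly_sum_single:
  "(f :: 'k::field mpoly) =
     (\<Sum>m \<in> Poly_Mapping.keys f. Poly_Mapping.single m (Poly_Mapping.lookup f m))"
  by (rule poly_mapping_eqI) (auto simp: lookup_sum lookup_single when_def in_keys_iff)

lemma mpoly_eval_mult: "mpoly_eval (f * g) v = mpoly_eval f v * mpoly_eval g v"
proof -
  have "f * g =
      (\<Sum>m \<in> Poly_Mapping.keys f. \<Sum>m' \<in> Poly_Mapping.keys g.
         Poly_Mapping.single (m + m') (Poly_Mapping.lookup f m * Poly_Mapping.lookup g m'))"
    by (subst mpoly_sum_single[of f], subst mpoly_sum_single[of g])
      (simp add: sum_product mult_single)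
  then show ?thesis
    by (simp add: mpoly_eval_sum mpoly_eval_single monom_eval_add)
      (simp add: mpoly_eval_def mpoly_insert_def sum_product mult_ac)
qed

lemma mpoly_eval_const [simp]: "mpoly_eval (mpoly_const c) v = c"
  by (simp add: mpoly_const_def mpoly_eval_single)

lemma mpoly_eval_var [simp]: "mpoly_eval (mpoly_var i) v = v $ i"
  by (simp add: mpoly_var_def mpoly_eval_single)

lemma mpoly_eval_power: "mpoly_eval (f ^ k) v = mpoly_eval f v ^ k"
  using mpoly_eval_const[of 1 v]
  by (induction k) (simp_all add: mpoly_eval_mult mpoly_const_def)

lemma mpoly_eval_prod: "mpoly_eval (\<Prod>x \<in> A. F x) v = (\<Prod>x \<in> A. mpoly_eval (F x) v)"
  using mpoly_eval_const[of 1 v]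
  by (induction A rule: infinite_finite_induct) (simp_all add: mpoly_eval_mult mpoly_const_def)

lemma mpoly_eval_KG_act:
  assumes "group G" "KG_module G n \<rho>" "g \<in> carrier G" "f \<in> mpoly_carrier n" "v \<in> carrier_vec n"
  shows "mpoly_eval (KG_act G n \<rho> g f) v = mpoly_eval f (\<rho> (inv\<^bsub>G\<^esub> g) *\<^sub>v v)"
proof -
  have dim: "\<rho> (inv\<^bsub>G\<^esub> g) \<in> carrier_mat n n"
    using assms by (simp add: KG_module_def group.inv_closed)
  have coord: "(\<rho> (inv\<^bsub>G\<^esub> g) *\<^sub>v v) $ i = (\<Sum>j<n. \<rho> (inv\<^bsub>G\<^esub> g) $$ (i, j) * v $ j)" if "i < n" for i
    using dim assms(5) that
    by (auto simp: scalar_prod_def lessThan_atLeast0 intro!: sum.cong)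
  have "i < n" if "m \<in> Poly_Mapping.keys f" "i \<in> Poly_Mapping.keys m" for m i
    using assms(4) that by (auto simp: mpoly_carrier_def)
  then show ?thesis
    by (simp add: KG_act_def mpoly_subst_def mpoly_insert_def mpoly_eval_def[of f] mpoly_eval_sum
        mpoly_eval_mult mpoly_eval_prod mpoly_eval_power coord)
qed

end

(*
  Upper bound. Encode v in K^n as a polynomial f(v) over K, so that one linear form with values in a
  domain separates points. Its components for the characters of the Klein four-group V are
  chi0, ..., chi3; then y = [chi0, chi1^2, chi2^2, chi3^2] and r = chi1 chi2 chi3 are V-invariant, of
  degrees 2 and 3, and separate V-orbits. Suppose that all invariants of degree at most 9 agree on v
  and w. Invariants of S_3 = S_4 / V of degree at most 4 in y show that, after moving v by an element
  of S_3, y takes the same values on the S_3-orbits of v and of w. Then r agrees up to sign, and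
  unless w is in the orbit of v it takes opposite nonzero values. This is excluded by the invariants
  (sum over S_3 of h r), where h has degree at most 3 in y, hence h r has degree at most 9.

  Lower bound. Tensor the permutation module K^4 with the sign character and let
  v = (1, x, -1-x, 0). Invariants of even degree agree on v and -v. An invariant of odd degree is
  a combination of alternants, which vanish unless their four exponents are distinct; in odd degree
  at most 8 these are 4, 2, 1, 0, and that alternant vanishes as well because the sum of the entries
  of v is 0. For generic x the vector -v is not in the orbit of v; over the field with five elements
  there is no such x.
*)

theory Submission
  imports Defs
begin

section \<open>The symmetric group of degree 3\<close>

text \<open>Newton's identities, with 2 and 3 cancellable, turn the power sums into the elementary
  symmetric functions. Both triples then consist of the roots of one monic cubic: \<open>a'\<close>
  is one of its roots, and the remaining pair is determined by its sum and product.\<close>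

lemma power_sums_three:
  fixes a b c a' b' c' :: "'a::idom"
  assumes char: "(2::'a) \<noteq> 0" "(3::'a) \<noteq> 0"
    and 1: "a + b + c = a' + b' + c'"
    and 2: "a\<^sup>2 + b\<^sup>2 + c\<^sup>2 = a'\<^sup>2 + b'\<^sup>2 + c'\<^sup>2"
    and 3: "a^3 + b^3 + c^3 = a'^3 + b'^3 + c'^3"
  shows "(a', b', c') \<in> {(a,b,c), (b,c,a), (c,a,b), (a,c,b), (b,a,c), (c,b,a)}"
proof -
  have *: "2 * (a*b + a*c + b*c) = (a + b + c)\<^sup>2 - (a\<^sup>2 + b\<^sup>2 + c\<^sup>2)" for a b c :: 'a
    by (simp add: algebra_simps power2_eq_square)
  have "2 * (a*b + a*c + b*c) = 2 * (a'*b' + a'*c' + b'*c')"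
    unfolding * 1 2 ..
  then have e2: "a*b + a*c + b*c = a'*b' + a'*c' + b'*c'"
    using char(1) mult_left_cancel by blast
  have *: "3 * (a*b*c) =
      (a^3 + b^3 + c^3) - (a + b + c) * ((a + b + c)\<^sup>2 - 3 * (a*b + a*c + b*c))" for a b c :: 'a
    by (simp add: algebra_simps power2_eq_square power3_eq_cube)
  have "3 * (a*b*c) = 3 * (a'*b'*c')"
    unfolding * 1 e2 3 ..
  then have e3: "a*b*c = a'*b'*c'"
    using char(2) mult_left_cancel by blast
  have *: "(z - x) * (z - y) = z*z - (x + y)*z + x*y" for x y z :: 'a
    by (simp add: algebra_simps)
  have pair: "z = x \<and> w = y \<or> z = y \<and> w = x"
    if "x + y = z + w" "x * y = z * w" for x y z w :: 'a
  proof -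
    have "(z - x) * (z - y) = 0"
      unfolding * that by (simp add: algebra_simps)
    then show ?thesis
      using that(1) by auto
  qed
  have *: "(z - a) * (z - b) * (z - c) =
      z*z*z - (a + b + c)*(z*z) + (a*b + a*c + b*c)*z - a*b*c" for a b c z :: 'a
    by (simp add: algebra_simps)
  have "(a' - a) * (a' - b) * (a' - c) = 0"
    unfolding * 1 e2 e3 by (simp add: algebra_simps)
  then consider "a' = a" | "a' = b" | "a' = c"
    by auto
  then show ?thesis
  proof cases
    case 1
    have "b + c = b' + c'" "b * c = b' * c'"
      using 1 \<open>a + b + c = _\<close> e2 by (simp_all add: distrib_left[symmetric] add.assoc)
    with pair[of b c b' c'] 1 show ?thesis by auto
  next
    case 2
    have s: "a + c = b' + c'"
      using 2 \<open>a + b + c = _\<close> by (simp add: ac_simps)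
    have "b * (a + c) + a * c = b * (b' + c') + b' * c'"
      using e2 2 by (simp add: algebra_simps)
    with s pair[of a c b' c'] 2 show ?thesis by auto
  next
    case 3
    have s: "a + b = b' + c'"
      using 3 \<open>a + b + c = _\<close> by (simp add: ac_simps)
    have "c * (a + b) + a * b = c * (b' + c') + b' * c'"
      using e2 3 by (simp add: algebra_simps)
    with s pair[of a b b' c'] 3 show ?thesis by auto
  qed
qed

lemma six_neq_zero:
  assumes "(2::'a::idom) \<noteq> 0" "(3::'a) \<noteq> 0"
  shows "(6::'a) \<noteq> 0"
proof -
  have "(6::'a) = 2 * 3" by simp
  then show ?thesis using assms by (metis mult_eq_0_iff)
qed

lemma diff_eq_if_sum_eq:
  fixes p q p' q' :: "'b::ab_group_add"
  assumes "p + q = p' + q'"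
  shows "q = q' - (p - p')"
  using assms by (simp add: algebra_simps)

section \<open>Actions of S_3 given by a rotation \<open>c\<close> and a reflection
  \<open>t\<close>\<close>

locale s3_action =
  fixes X :: "'v set" and c t :: "'v \<Rightarrow> 'v"
  assumes c_closed [simp]: "x \<in> X \<Longrightarrow> c x \<in> X"
    and t_closed [simp]: "x \<in> X \<Longrightarrow> t x \<in> X"
    and ccc [simp]: "x \<in> X \<Longrightarrow> c (c (c x)) = x"
    and tt [simp]: "x \<in> X \<Longrightarrow> t (t x) = x"
    and ct [simp]: "x \<in> X \<Longrightarrow> c (t x) = t (c (c x))"
begin

text \<open>The six words are the normal forms to which the simp rules of the locale reduce all
  words in \<open>c\<close> and \<open>t\<close>. The points need not be distinct, so
  \<open>S\<close> sums over the group and not over the orbit.\<close>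

definition orb :: "'v \<Rightarrow> 'v set" where
  "orb x = {x, c x, c (c x), t x, t (c x), t (c (c x))}"

definition S :: "('v \<Rightarrow> 'b::comm_ring_1) \<Rightarrow> 'v \<Rightarrow> 'b" where
  "S F x = F x + F (c x) + F (c (c x)) + F (t x) + F (t (c x)) + F (t (c (c x)))"

definition same :: "('v \<Rightarrow> 'b) \<Rightarrow> 'v \<Rightarrow> 'v \<Rightarrow> bool" where
  "same y u w \<longleftrightarrow> y u = y w \<and> y (c u) = y (c w) \<and> y (c (c u)) = y (c (c w)) \<and>
     y (t u) = y (t w) \<and> y (t (c u)) = y (t (c w)) \<and> y (t (c (c u))) = y (t (c (c w)))"

text \<open>
  The coefficients of \<open>xi y x\<close> are the \<open>t\<close>-invariant combinations of the values of \<open>y\<close> on the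
  orbit of \<open>x\<close>. Packing them into one polynomial replaces the choice of a generic linear combination,
  which a finite field need not provide; \<open>quad\<close> below uses the same device.
\<close>

definition xi :: "('v \<Rightarrow> 'b::comm_ring_1) \<Rightarrow> 'v \<Rightarrow> 'b poly" where
  "xi y x = [: y x + y (t x), y (c x) + y (c (t x)), y (c (c x)) + y (c (c (t x))) :]"

text \<open>The sum over S_3 twisted by the sign character.\<close>

definition alt :: "('v \<Rightarrow> 'b::comm_ring_1) \<Rightarrow> 'v \<Rightarrow> 'b" where
  "alt y x = y x + y (c x) + y (c (c x)) - y (t x) - y (t (c x)) - y (t (c (c x)))"

text \<open>Meant for the \<open>t\<close>-invariant function \<open>f = xi y\<close>, where this
  Vandermonde product is fixed by \<open>c\<close> and negated by \<open>t\<close>, just as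
  \<open>alt y\<close> is.\<close>

definition vdm :: "('v \<Rightarrow> 'b::comm_ring_1) \<Rightarrow> 'v \<Rightarrow> 'b" where
  "vdm f x = (f x - f (c x)) * (f x - f (c (c x))) * (f (c x) - f (c (c x)))"

section \<open>Separation of S_3-orbits, and twisted sums over them\<close>

lemma xi_t [simp]: "x \<in> X \<Longrightarrow> xi y (t x) = xi y x"
  by (simp add: xi_def add.commute)

lemma alt_c [simp]: "x \<in> X \<Longrightarrow> alt y (c x) = alt y x"
  by (simp add: alt_def)

lemma alt_t [simp]: "x \<in> X \<Longrightarrow> alt y (t x) = - alt y x"
  by (simp add: alt_def)

lemma orb_closed: "x \<in> X \<Longrightarrow> u \<in> orb x \<Longrightarrow> u \<in> X"
  by (auto simp: orb_def)

lemma orb_trans: "x \<in> X \<Longrightarrow> u \<in> orb x \<Longrightarrow> z \<in> orb u \<Longrightarrow> z \<in> orb x"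
  by (auto simp: orb_def)

lemma S_c: "x \<in> X \<Longrightarrow> S F (c x) = S F x"
  by (simp add: S_def)

lemma S_if_const_on_orb:
  assumes "\<And>u. u \<in> orb x \<Longrightarrow> F u = F x"
  shows "S F x = 6 * F x"
proof -
  have "F (c x) = F x" "F (c (c x)) = F x" "F (t x) = F x" "F (t (c x)) = F x" "F (t (c (c x))) = F x"
    by (rule assms; simp add: orb_def)+
  then show ?thesis
    by (simp add: S_def)
qed

text \<open>Among the values of \<open>y\<close> on an orbit, \<open>xi\<close> records all sums of
  one value at a rotation and one at a reflection. This leaves one degree of freedom
  \<open>e\<close>, added at the rotations and subtracted at the reflections, and it changes
  \<open>alt y\<close> by \<open>6 * e\<close>. In other words, \<open>xi\<close> misses only the
  sign component.\<close>

lemma same_if_xi_alt: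
  fixes y :: "'v \<Rightarrow> 'b::idom"
  assumes char: "(2::'b) \<noteq> 0" "(3::'b) \<noteq> 0" and X: "u \<in> X" "w \<in> X"
    and xi: "xi y u = xi y w" "xi y (c u) = xi y (c w)" "xi y (c (c u)) = xi y (c (c w))"
    and D: "alt y u = alt y w"
  shows "same y u w"
proof -
  have *: "y u + y (t u) = y w + y (t w)"
    "y (c u) + y (t (c (c u))) = y (c w) + y (t (c (c w)))"
    "y (c (c u)) + y (t (c u)) = y (c (c w)) + y (t (c w))"
    "y (c u) + y (t (c u)) = y (c w) + y (t (c w))"
    "y (c (c u)) + y (t u) = y (c (c w)) + y (t w)"
    "y u + y (t (c (c u))) = y w + y (t (c (c w)))"
    using xi(1,2) X by (simp_all add: xi_def)
  have **: "p0 = p0' \<and> p1 = p1' \<and> p2 = p2' \<and> q0 = q0' \<and> q1 = q1' \<and> q2 = q2'"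
    if h: "p0 + q0 = p0' + q0'" "p1 + q2 = p1' + q2'" "p2 + q1 = p2' + q1'"
      "p1 + q1 = p1' + q1'" "p2 + q0 = p2' + q0'" "p0 + q2 = p0' + q2'"
      "p0 + p1 + p2 - q0 - q1 - q2 = p0' + p1' + p2' - q0' - q1' - q2'"
    for p0 p1 p2 q0 q1 q2 p0' p1' p2' q0' q1' q2' :: 'b
  proof -
    define e where "e = p0 - p0'"
    have 1: "p0 = p0' + e" by (simp add: e_def)
    have 2: "q0 = q0' - e" "q2 = q2' - e"
      using diff_eq_if_sum_eq[OF h(1)] diff_eq_if_sum_eq[OF h(6)] by (simp_all add: e_def)
    have 3: "p1 = p1' + e" "p2 = p2' + e"
      using h(2,5) unfolding 2 by (simp_all add: algebra_simps)
    have 4: "q1 = q1' - e"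
      using diff_eq_if_sum_eq[OF h(4)] unfolding 3 by simp
    have "2 * (3 * e) = 0"
      using h(7) unfolding 1 2 3 4 by (simp add: algebra_simps)
    then have "e = 0" using six_neq_zero[OF char] by simp
    then show ?thesis using 1 2 3 4 by simp
  qed
  show ?thesis
    unfolding same_def
    using **[OF *] D by (simp add: alt_def)
qed

lemma vdm_orb: "x \<in> X \<Longrightarrow> u \<in> orb x \<Longrightarrow>
    (alt y u)\<^sup>2 = (alt y x)\<^sup>2 \<and> [:alt y u:] * vdm (xi y) u = [:alt y x:] * vdm (xi y) x"
  by (auto simp: orb_def vdm_def algebra_simps)

text \<open>The power sums determine the three values of \<open>xi y\<close> up to a permutation,
  and every permutation is realised within the orbit. What remains is the sign of
  \<open>alt y\<close>, which the product with \<open>vdm (xi y)\<close> ties to the order of these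
  values. The functions summed have degree at most 4 in \<open>y\<close>.\<close>

lemma orbit_separation:
  fixes y :: "'v \<Rightarrow> 'b::idom"
  assumes char: "(2::'b) \<noteq> 0" "(3::'b) \<noteq> 0" and X: "v \<in> X" "w \<in> X"
    and p: "S (xi y) v = S (xi y) w" "S (\<lambda>x. (xi y x)\<^sup>2) v = S (\<lambda>x. (xi y x)\<^sup>2) w"
      "S (\<lambda>x. xi y x ^ 3) v = S (\<lambda>x. xi y x ^ 3) w"
    and D2: "S (\<lambda>x. (alt y x)\<^sup>2) v = S (\<lambda>x. (alt y x)\<^sup>2) w"
    and DV: "S (\<lambda>x. [:alt y x:] * vdm (xi y) x) v = S (\<lambda>x. [:alt y x:] * vdm (xi y) x) w"
  shows "\<exists>u \<in> orb v. same y u w"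
proof -
  have char': "(2::'b poly) \<noteq> 0" "(3::'b poly) \<noteq> 0"
    using char by (simp_all add: numeral_poly)
  have dbl: "p + q + s = p' + q' + s'" if "p + q + s + p + q + s = p' + q' + s' + p' + q' + s'"
    for p q s p' q' s' :: "'b poly"
  proof -
    have "2 * (p + q + s) = 2 * (p' + q' + s')" using that by (simp add: algebra_simps)
    then show ?thesis using char' mult_left_cancel by blast
  qed
  \<comment> \<open>Each of the three values occurs twice in \<open>S\<close>, because
    \<open>xi y\<close> is \<open>t\<close>-invariant; \<open>dbl\<close> halves the sums.\<close>
  have "(xi y w, xi y (c w), xi y (c (c w))) \<in>
    {(xi y v, xi y (c v), xi y (c (c v))), (xi y (c v), xi y (c (c v)), xi y v),
     (xi y (c (c v)), xi y v, xi y (c v)), (xi y v, xi y (c (c v)), xi y (c v)),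
     (xi y (c v), xi y v, xi y (c (c v))), (xi y (c (c v)), xi y (c v), xi y v)}"
    by (rule power_sums_three[OF char'], rule_tac [!] dbl)
      (use p X in \<open>simp_all add: S_def add_ac\<close>)
  also have "\<dots> = (\<lambda>u. (xi y u, xi y (c u), xi y (c (c u)))) ` orb v"
    using X by (simp add: orb_def)
  finally obtain u where u: "u \<in> orb v" "xi y u = xi y w" "xi y (c u) = xi y (c w)"
    "xi y (c (c u)) = xi y (c (c w))" by auto
  have uX: "u \<in> X" using u X orb_closed by blast
  have "6 * (alt y w)\<^sup>2 = 6 * (alt y u)\<^sup>2"
    using D2 X uX vdm_orb[OF X(1) u(1), of y]
    by (auto simp: S_if_const_on_orb vdm_orb)
  then have "(alt y w)\<^sup>2 = (alt y u)\<^sup>2"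
    using six_neq_zero[OF char] by simp
  then consider "alt y u = alt y w" | "alt y w = - alt y u"
    by (auto simp: power2_eq_iff)
  then show ?thesis
  proof cases
    case 1
    then show ?thesis using same_if_xi_alt[OF char uX X(2)] u by blast
  next
    \<comment> \<open>For opposite signs of \<open>alt y\<close>, the product of
      \<open>alt y\<close> and \<open>vdm (xi y)\<close> has to vanish: it agrees at
      \<open>u\<close> and \<open>w\<close>, and so does \<open>vdm (xi y)\<close>.\<close>
    case 2
    have K: "S (\<lambda>x. [:alt y x:] * vdm (xi y) x) z = 6 * ([:alt y z:] * vdm (xi y) z)"
      if "z \<in> X" for z
      by (rule S_if_const_on_orb) (use vdm_orb[OF that] in blast)
    have "6 * ([:alt y w:] * vdm (xi y) w) = 6 * ([:alt y v:] * vdm (xi y) v)"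
      using DV K X by simp
    then have "[:alt y w:] * vdm (xi y) w = [:alt y v:] * vdm (xi y) v"
      by (rule iffD1[OF mult_left_cancel[OF six_neq_zero[OF char']]])
    also have "\<dots> = [:alt y u:] * vdm (xi y) u"
      using vdm_orb[OF X(1) u(1), of y] by simp
    finally have "[:alt y w:] * vdm (xi y) w = [:alt y u:] * vdm (xi y) u" .
    moreover have "vdm (xi y) w = vdm (xi y) u"
      using u by (simp add: vdm_def)
    moreover have "[:alt y w:] = - [:alt y u:]"
      using 2 by simp
    moreover have "2 * p = 0" if "- p = p" for p :: "'b poly"
      using that by (metis add.right_inverse mult_2)
    ultimately have "2 * ([:alt y u:] * vdm (xi y) u) = 0"
      by (metis mult_minus_left)
    then have "alt y u = 0 \<or> vdm (xi y) u = 0"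
      using char' by simp
    then consider "alt y u = 0" | "xi y u = xi y (c u)" | "xi y u = xi y (c (c u))"
      | "xi y (c u) = xi y (c (c u))"
      by (auto simp: vdm_def)
    \<comment> \<open>If \<open>alt y u = 0\<close>, then \<open>u\<close> itself serves. Otherwise
      the reflection that exchanges two coinciding values of \<open>xi y\<close> keeps the triple
      and negates \<open>alt y\<close>.\<close>
    then have "\<exists>z \<in> orb u. xi y z = xi y w \<and> xi y (c z) = xi y (c w) \<and>
      xi y (c (c z)) = xi y (c (c w)) \<and> alt y z = alt y w"
      using 2 u uX by cases (auto simp: orb_def)
    then show ?thesis
      using same_if_xi_alt[OF char _ X(2)] orb_closed[OF uX] orb_trans[OF X(1) u(1)] by blast
  qed
qed

text \<open>In each case a product of at most two factors vanishes at the group translates of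
  \<open>v\<close> whose \<open>y\<close>-values differ from those at \<open>v\<close>. At the other
  translates \<open>r\<close> equals \<open>r v\<close>, so the sum is a nonzero multiple of
  \<open>r v\<close>.\<close>

lemma twisted_sum_nonzero_if_xi_eq:
  fixes y :: "'v \<Rightarrow> 'b::idom" and r :: "'v \<Rightarrow> 'b poly"
  assumes char: "(2::'b) \<noteq> 0" "(3::'b) \<noteq> 0" and X: "v \<in> X"
    and r: "\<And>u u'. u \<in> orb v \<Longrightarrow> u' \<in> orb v \<Longrightarrow> same y u u' \<Longrightarrow> r u = r u'"
    and nz: "r v \<noteq> 0"
    and xi12: "xi y (c v) = xi y (c (c v))"
    and 2: "\<And>p q. S (\<lambda>x. ([:alt y x:] - p) * (xi y x - q) * r x) v = 0"
    and 1: "\<And>q. S (\<lambda>x. (xi y x - q) * r x) v = 0"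
    and alt1: "\<And>p. S (\<lambda>x. ([:alt y x:] - p) * r x) v = 0"
    and 0: "S r v = 0"
  shows False
proof -
  have char': "(2::'b poly) \<noteq> 0" "(3::'b poly) \<noteq> 0"
    using char by (simp_all add: numeral_poly)
  have vo: "v \<in> orb v" by (simp add: orb_def)
  have eq: "r u = r v" if "u \<in> orb v" "xi y u = xi y v" "xi y (c u) = xi y (c v)"
    "xi y (c (c u)) = xi y (c (c v))" "alt y u = alt y v" for u
    by (rule r[OF that(1) vo same_if_xi_alt[OF char orb_closed[OF X that(1)] X that(2-)]])
  have D2: "alt y v = 0" if "alt y v + alt y v = 0"
    using that char(1) by (metis mult_2 mult_eq_0_iff)
  show False
  proof (cases "xi y v = xi y (c v)")
    case False
    show False
    proof (cases "alt y v = 0")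
      case nzD: False
      \<comment> \<open>The factor in \<open>xi y\<close> kills all words but \<open>v\<close> and
        \<open>t v\<close>; the factor in \<open>alt y\<close> kills \<open>t v\<close>.\<close>
      have "(([:alt y v:] + [:alt y v:]) * (xi y v - xi y (c v))) * r v = 0"
        using 2[of "- [:alt y v:]" "xi y (c v)"] X xi12 by (simp add: S_def)
      then show False
        using False nz nzD D2 by auto
    next
      case D: True
      have "r (t v) = r v"
        by (rule eq) (use X xi12 D in \<open>auto simp: orb_def\<close>)
      then have "2 * ((xi y v - xi y (c v)) * r v) = 0"
        using 1[of "xi y (c v)"] X xi12 by (auto simp: S_def)
      then show False
        using False nz char' by auto
    qed
  next
    case True
    have rot: "r (c v) = r v" "r (c (c v)) = r v"
      by (rule eq; use X xi12 True in \<open>auto simp: orb_def\<close>)+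
    show False
    proof (cases "alt y v = 0")
      case nzD: False
      have "3 * z = z + z + z" for z :: "'b poly"
        by simp
      then have "3 * (([:alt y v:] + [:alt y v:]) * r v) = 0"
        using alt1[of "- [:alt y v:]"] X rot by (simp only: S_def) simp
      then show False
        using nz nzD D2 char' by auto
    next
      case D: True
      have "r (t v) = r v" "r (t (c v)) = r v" "r (t (c (c v))) = r v"
        by (rule eq; use X xi12 True D in \<open>auto simp: orb_def\<close>)+
      then have "6 * r v = 0"
        using 0 rot by (simp add: S_def)
      then show False
        using nz six_neq_zero[OF char'] by auto
    qed
  qed
qed

text \<open>
  If \<open>p = xi y (c v)\<close>, \<open>q = s = xi y (c (c v))\<close> and \<open>vdm (xi y) v \<noteq> 0\<close>, then the cubic factor
  below vanishes on the orbit of \<open>v\<close> except at \<open>v\<close>. If two of the three values of \<open>xi y\<close> coincide,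
  then factors of degree at most 2 suffice.
\<close>

lemma twisted_sum_nonzero:
  fixes y :: "'v \<Rightarrow> 'b::idom" and r :: "'v \<Rightarrow> 'b poly"
  assumes char: "(2::'b) \<noteq> 0" "(3::'b) \<noteq> 0" and X: "v \<in> X"
    and r: "\<And>u u'. u \<in> orb v \<Longrightarrow> u' \<in> orb v \<Longrightarrow> same y u u' \<Longrightarrow> r u = r u'"
    and nz: "\<And>u. u \<in> orb v \<Longrightarrow> r u \<noteq> 0"
    and 3: "\<And>p q s. S (\<lambda>x. (xi y x - p) * (xi y x - q) * (xi y (c x) - s) * r x) v = 0"
    and 2: "\<And>p q. S (\<lambda>x. ([:alt y x:] - p) * (xi y x - q) * r x) v = 0"
    and 1: "\<And>q. S (\<lambda>x. (xi y x - q) * r x) v = 0"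
    and alt1: "\<And>p. S (\<lambda>x. ([:alt y x:] - p) * r x) v = 0"
    and 0: "S r v = 0"
  shows False
proof (cases "vdm (xi y) v = 0")
  case False
  have "(xi y v - xi y (c v)) * (xi y v - xi y (c (c v))) * (xi y (c v) - xi y (c (c v))) * r v = 0"
    using 3[of "xi y (c v)" "xi y (c (c v))" "xi y (c (c v))"] X by (simp add: S_def)
  then show False
    using False nz[of v] by (auto simp: vdm_def orb_def)
next
  case True
  \<comment> \<open>A rotation moves the coinciding values to \<open>c u\<close> and
    \<open>c (c u)\<close>, and it does not change \<open>S\<close>.\<close>
  then have "\<exists>u. (u = v \<or> u = c v \<or> u = c (c v)) \<and> xi y (c u) = xi y (c (c u))"
    using X by (auto simp: vdm_def)
  then obtain u where u: "u = v \<or> u = c v \<or> u = c (c v)" "xi y (c u) = xi y (c (c u))"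
    by blast
  have S: "S F u = S F v" for F :: "'v \<Rightarrow> 'b poly"
    using u(1) X by (auto simp: S_c)
  have o: "u \<in> orb v" using u by (auto simp: orb_def)
  show False
  proof (rule twisted_sum_nonzero_if_xi_eq[OF char orb_closed[OF X o], where y = y and r = r])
    show "r z = r z'" if "z \<in> orb u" "z' \<in> orb u" "same y z z'" for z z'
      using r orb_trans[OF X o] that by blast
  qed (use nz[OF o] u(2) in \<open>simp_all only: S 2 1 alt1 0 not_False_eq_True\<close>)
qed

end

section \<open>Functions filtered by degree\<close>

text \<open>Abstracts the property of being a polynomial function of degree at most
  \<open>d\<close>. In this form the degree rules pass to \<open>coeffwise P\<close>, hence also to
  functions whose values are polynomials over polynomials.\<close>

definition filtration :: "(nat \<Rightarrow> ('v \<Rightarrow> 'b::comm_ring_1) \<Rightarrow> bool) \<Rightarrow> bool" where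
  "filtration P \<longleftrightarrow> (\<forall>d k. P d (\<lambda>_. k)) \<and>
     (\<forall>d F G. P d F \<longrightarrow> P d G \<longrightarrow> P d (\<lambda>v. F v + G v)) \<and>
     (\<forall>d e F G. P d F \<longrightarrow> P e G \<longrightarrow> P (d + e) (\<lambda>v. F v * G v)) \<and>
     (\<forall>d e F. P d F \<longrightarrow> d \<le> e \<longrightarrow> P e F)"

definition coeffwise :: "(nat \<Rightarrow> ('v \<Rightarrow> 'b::comm_ring_1) \<Rightarrow> bool) \<Rightarrow> nat \<Rightarrow> ('v \<Rightarrow> 'b poly) \<Rightarrow> bool" where
  "coeffwise P d F \<longleftrightarrow> (\<forall>i. P d (\<lambda>v. coeff (F v) i))"

context
  fixes P :: "nat \<Rightarrow> ('v \<Rightarrow> 'b::comm_ring_1) \<Rightarrow> bool"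
  assumes P: "filtration P"
begin

lemma filtration_const: "P d (\<lambda>_. k)"
  using P by (simp add: filtration_def)

lemma filtration_mono: "P d F \<Longrightarrow> d \<le> e \<Longrightarrow> P e F"
  using P unfolding filtration_def by blast

lemma filtration_add: "P d F \<Longrightarrow> P d G \<Longrightarrow> P d (\<lambda>v. F v + G v)"
  using P by (simp add: filtration_def)

lemma filtration_mult: "P d F \<Longrightarrow> P e G \<Longrightarrow> d + e \<le> n \<Longrightarrow> P n (\<lambda>v. F v * G v)"
  using P unfolding filtration_def by blast

lemma filtration_diff: "P d F \<Longrightarrow> P d G \<Longrightarrow> P d (\<lambda>v. F v - G v)"
  using filtration_add[of d F "\<lambda>v. - 1 * G v"] filtration_mult[OF filtration_const[of 0 "- 1"], of d G d]
  by simp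

lemma filtration_sum: "(\<And>i. i \<in> I \<Longrightarrow> P d (F i)) \<Longrightarrow> P d (\<lambda>v. \<Sum>i\<in>I. F i v)"
  by (induction I rule: infinite_finite_induct) (simp_all add: filtration_const filtration_add)

lemma filtration_power: "P d F \<Longrightarrow> k * d \<le> n \<Longrightarrow> P n (\<lambda>v. F v ^ k)"
proof (induction k arbitrary: n)
  case (Suc k)
  show ?case
    using filtration_mult[OF Suc.prems(1) Suc.IH[of "k * d"]] Suc.prems by simp
qed (simp add: filtration_const)

text \<open>A coefficient of a product is a sum of products of coefficients, so degrees still
  add.\<close>

lemma filtration_coeffwise: "filtration (coeffwise P)"
  unfolding filtration_def coeffwise_def
proof (intro conjI allI impI)
  fix d e i and F G :: "'v \<Rightarrow> 'b poly"
  assume "\<forall>i. P d (\<lambda>v. coeff (F v) i)" "\<forall>i. P e (\<lambda>v. coeff (G v) i)"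
  then show "P (d + e) (\<lambda>v. coeff (F v * G v) i)"
    unfolding coeff_mult by (intro filtration_sum filtration_mult) auto
qed (auto simp: filtration_const filtration_add intro: filtration_mono)

lemma coeffwise_pCons:
  "P d F \<Longrightarrow> coeffwise P d G \<Longrightarrow> coeffwise P d (\<lambda>v. pCons (F v) (G v))"
  unfolding coeffwise_def
proof
  fix i assume "P d F" "\<forall>i. P d (\<lambda>v. coeff (G v) i)"
  then show "P d (\<lambda>v. coeff (pCons (F v) (G v)) i)"
    by (cases i) simp_all
qed

lemma coeffwise_const: "coeffwise P d (\<lambda>_. k)"
  by (simp add: coeffwise_def filtration_const)

end

section \<open>The symmetric group of degree 4\<close>

text \<open>\<open>a\<close> and \<open>b\<close> generate the Klein four-group, \<open>c\<close> and \<open>t\<close> a complement of it.\<close>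

locale s4_action = s3_action X c t for X :: "'v set" and c t :: "'v \<Rightarrow> 'v" +
  fixes a b :: "'v \<Rightarrow> 'v"
  assumes a_closed [simp]: "x \<in> X \<Longrightarrow> a x \<in> X"
    and b_closed [simp]: "x \<in> X \<Longrightarrow> b x \<in> X"
    and aa [simp]: "x \<in> X \<Longrightarrow> a (a x) = x"
    and bb [simp]: "x \<in> X \<Longrightarrow> b (b x) = x"
    and ba [simp]: "x \<in> X \<Longrightarrow> b (a x) = a (b x)"
    and ca [simp]: "x \<in> X \<Longrightarrow> c (a x) = a (b (c x))"
    and cb [simp]: "x \<in> X \<Longrightarrow> c (b x) = a (c x)"
    and ta [simp]: "x \<in> X \<Longrightarrow> t (a x) = a (t x)"
    and tb [simp]: "x \<in> X \<Longrightarrow> t (b x) = a (b (t x))"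
begin

text \<open>
  Up to the factor \<open>4\<close>, these are the components of \<open>f\<close> for the trivial (\<open>chi0\<close>) and the
  nontrivial characters of the Klein four-group.
\<close>

definition chi0 :: "('v \<Rightarrow> 'b::comm_ring_1) \<Rightarrow> 'v \<Rightarrow> 'b" where
  "chi0 f v = f v + f (a v) + f (b v) + f (a (b v))"

definition chi1 :: "('v \<Rightarrow> 'b::comm_ring_1) \<Rightarrow> 'v \<Rightarrow> 'b" where
  "chi1 f v = f v + f (a v) - f (b v) - f (a (b v))"

definition chi2 :: "('v \<Rightarrow> 'b::comm_ring_1) \<Rightarrow> 'v \<Rightarrow> 'b" where
  "chi2 f v = f v - f (a v) + f (b v) - f (a (b v))"

definition chi3 :: "('v \<Rightarrow> 'b::comm_ring_1) \<Rightarrow> 'v \<Rightarrow> 'b" where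
  "chi3 f v = f v - f (a v) - f (b v) + f (a (b v))"

definition quad :: "('v \<Rightarrow> 'b::comm_ring_1) \<Rightarrow> 'v \<Rightarrow> 'b poly" where
  "quad f v = [:chi0 f v, (chi1 f v)\<^sup>2, (chi2 f v)\<^sup>2, (chi3 f v)\<^sup>2:]"

definition cub :: "('v \<Rightarrow> 'b::comm_ring_1) \<Rightarrow> 'v \<Rightarrow> 'b" where
  "cub f v = chi1 f v * chi2 f v * chi3 f v"

section \<open>Separation of orbits of the Klein four-group\<close>

lemma chi_a:
  assumes "v \<in> X"
  shows "chi0 f (a v) = chi0 f v" "chi1 f (a v) = chi1 f v"
    "chi2 f (a v) = - chi2 f v" "chi3 f (a v) = - chi3 f v"
  using assms by (simp_all add: chi0_def chi1_def chi2_def chi3_def)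

lemma chi_b:
  assumes "v \<in> X"
  shows "chi0 f (b v) = chi0 f v" "chi1 f (b v) = - chi1 f v"
    "chi2 f (b v) = chi2 f v" "chi3 f (b v) = - chi3 f v"
  using assms by (simp_all add: chi0_def chi1_def chi2_def chi3_def)

lemma quad_invariant [simp]: "v \<in> X \<Longrightarrow> quad f (a v) = quad f v" "v \<in> X \<Longrightarrow> quad f (b v) = quad f v"
  by (simp_all add: quad_def chi_a chi_b)

lemma cub_invariant [simp]: "v \<in> X \<Longrightarrow> cub f (a v) = cub f v" "v \<in> X \<Longrightarrow> cub f (b v) = cub f v"
  by (simp_all add: cub_def chi_a chi_b)

text \<open>The square of \<open>cub f\<close> is the product of the three squares among the
  coefficients of \<open>quad f\<close>.\<close>

lemma cub_eq_or_neg: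
  fixes f :: "'v \<Rightarrow> 'b::idom"
  assumes "quad f u = quad f w"
  shows "cub f w = cub f u \<or> cub f w = - cub f u"
proof -
  have "(cub f w)\<^sup>2 = (cub f u)\<^sup>2"
    using assms by (simp add: quad_def cub_def power_mult_distrib)
  then show ?thesis
    by (simp add: power2_eq_iff)
qed

text \<open>The value of \<open>quad\<close> fixes each nontrivial component up to sign, and
  \<open>cub\<close> restricts to an even number of sign changes. These are exactly the changes made
  by the group. Since \<open>4 * f\<close> is the sum of the components and \<open>f\<close> is
  injective, equal components mean equal points.\<close>

lemma klein_orbit:
  fixes f :: "'v \<Rightarrow> 'b::idom"
  assumes "(2::'b) \<noteq> 0" "inj_on f X" and X: "u \<in> X" "w \<in> X"
    and q: "quad f u = quad f w" and r: "cub f u = cub f w"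
  shows "w = u \<or> w = a u \<or> w = b u \<or> w = a (b u)"
proof -
  have eqI: "w = z" if z: "z \<in> X" "chi0 f w = chi0 f z" "chi1 f w = chi1 f z"
    "chi2 f w = chi2 f z" "chi3 f w = chi3 f z" for z
  proof -
    have *: "2 * (2 * f y) = chi0 f y + chi1 f y + chi2 f y + chi3 f y" for y
      by (simp add: chi0_def chi1_def chi2_def chi3_def)
    have "2 * (2 * f w) = 2 * (2 * f z)"
      unfolding * using z by simp
    then have "f w = f z"
      using assms(1) mult_left_cancel by metis
    then show ?thesis
      using assms(2) X z by (auto dest: inj_onD)
  qed
  have eq: "chi0 f w = chi0 f u" "chi1 f w = chi1 f u \<or> chi1 f w = - chi1 f u"
    "chi2 f w = chi2 f u \<or> chi2 f w = - chi2 f u" "chi3 f w = chi3 f u \<or> chi3 f w = - chi3 f u"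
    using q by (auto simp: quad_def power2_eq_iff)
  have dbl: "s = 0" if "s = - s" for s :: 'b
    using that assms(1) by (metis add.right_inverse mult_2 mult_eq_0_iff)
  \<comment> \<open>An odd number of sign changes negates \<open>cub\<close>; then
    \<open>cub\<close> is 0, and so is one of its factors, whose sign may be chosen at will.\<close>
  have zero: "chi1 f u = 0 \<or> chi2 f u = 0 \<or> chi3 f u = 0" if "cub f w = - cub f u"
    using dbl[of "cub f u"] that r by (auto simp: cub_def)
  define E where "E p q s \<longleftrightarrow> chi1 f w = p \<and> chi2 f w = q \<and> chi3 f w = s" for p q s
  have "E (chi1 f u) (chi2 f u) (chi3 f u) \<or> E (chi1 f u) (- chi2 f u) (- chi3 f u) \<or>
    E (- chi1 f u) (chi2 f u) (- chi3 f u) \<or> E (- chi1 f u) (- chi2 f u) (chi3 f u)"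
    using eq(2-4) zero unfolding E_def by (elim disjE) (use assms(1) in \<open>auto simp: cub_def\<close>)
  then show ?thesis
  proof (elim disjE)
    assume "E (chi1 f u) (chi2 f u) (chi3 f u)"
    with eqI[of u] eq(1) X show ?thesis by (simp add: E_def)
  next
    assume "E (chi1 f u) (- chi2 f u) (- chi3 f u)"
    with eqI[of "a u"] eq(1) X show ?thesis by (simp add: E_def chi_a)
  next
    assume "E (- chi1 f u) (chi2 f u) (- chi3 f u)"
    with eqI[of "b u"] eq(1) X show ?thesis by (simp add: E_def chi_b)
  next
    assume "E (- chi1 f u) (- chi2 f u) (chi3 f u)"
    with eqI[of "a (b u)"] eq(1) X show ?thesis by (simp add: E_def chi_a chi_b)
  qed
qed

section \<open>Moments of invariant functions, and the degrees of the functions used\<close>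

definition equivariant_filtration :: "(nat \<Rightarrow> ('v \<Rightarrow> 'b::comm_ring_1) \<Rightarrow> bool) \<Rightarrow> bool" where
  "equivariant_filtration P \<longleftrightarrow> filtration P \<and>
     (\<forall>d F. P d F \<longrightarrow> P d (\<lambda>v. F (a v)) \<and> P d (\<lambda>v. F (b v)) \<and> P d (\<lambda>v. F (c v)) \<and> P d (\<lambda>v. F (t v)))"

text \<open>For a function invariant under the Klein four-group, \<open>4 * S F\<close> is the sum
  over S_4 (\<open>sum_S4_eq\<close>), so this compares values of invariants of degree at most
  9.\<close>

definition same_moments :: "(nat \<Rightarrow> ('v \<Rightarrow> 'b::comm_ring_1) \<Rightarrow> bool) \<Rightarrow> 'v \<Rightarrow> 'v \<Rightarrow> bool" where
  "same_moments P v w \<longleftrightarrow>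
     (\<forall>F. P 9 F \<longrightarrow> (\<forall>x\<in>X. F (a x) = F x \<and> F (b x) = F x) \<longrightarrow> S F v = S F w)"

lemma equivariant_filtration_coeffwise:
  "equivariant_filtration P \<Longrightarrow> equivariant_filtration (coeffwise P)"
  unfolding equivariant_filtration_def using filtration_coeffwise
  unfolding coeffwise_def[abs_def] by blast

lemma same_moments_coeffwise:
  assumes "same_moments P v w"
  shows "same_moments (coeffwise P) v w"
  unfolding same_moments_def
proof (intro allI impI)
  fix F assume F: "coeffwise P 9 F" "\<forall>x\<in>X. F (a x) = F x \<and> F (b x) = F x"
  have *: "coeff (S F x) i = S (\<lambda>x. coeff (F x) i) x" for x i
    by (simp add: S_def)
  show "S F v = S F w"
  proof (rule poly_eqI)
    fix i
    show "coeff (S F v) i = coeff (S F w) i"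
      unfolding * using assms F by (auto simp: same_moments_def coeffwise_def)
  qed
qed

context
  fixes P :: "nat \<Rightarrow> ('v \<Rightarrow> 'b::comm_ring_1) \<Rightarrow> bool"
  assumes P: "equivariant_filtration P"
begin

lemma filtr: "filtration P"
  using P by (simp add: equivariant_filtration_def)

lemma degree_klein:
  assumes "P d y"
  shows "P d (\<lambda>v. y (a v))" "P d (\<lambda>v. y (b v))" "P d (\<lambda>v. y (a (b v)))"
proof -
  have 1: "P d (\<lambda>v. F (a v))" "P d (\<lambda>v. F (b v))" if "P d F" for F
    using P that by (simp_all add: equivariant_filtration_def)
  show "P d (\<lambda>v. y (a v))" "P d (\<lambda>v. y (b v))" by (rule 1[OF assms])+
  show "P d (\<lambda>v. y (a (b v)))" by (rule 1(2)[OF 1(1)[OF assms]])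
qed

lemma degree_comp:
  assumes "P d y"
  shows "P d (\<lambda>v. y (c v))" "P d (\<lambda>v. y (t v))" "P d (\<lambda>v. y (c (c v)))" "P d (\<lambda>v. y (t (c v)))"
    "P d (\<lambda>v. y (t (c (c v))))" "P d (\<lambda>v. y (c (t v)))" "P d (\<lambda>v. y (c (c (t v))))"
proof -
  have 1: "P d (\<lambda>v. F (c v))" "P d (\<lambda>v. F (t v))" if "P d F" for F
    using P that by (simp_all add: equivariant_filtration_def)
  show c: "P d (\<lambda>v. y (c v))" and t: "P d (\<lambda>v. y (t v))" by (rule 1[OF assms])+
  show cc: "P d (\<lambda>v. y (c (c v)))" by (rule 1(1)[OF c])
  show tc: "P d (\<lambda>v. y (t (c v)))" by (rule 1(1)[OF t])
  show "P d (\<lambda>v. y (t (c (c v))))" by (rule 1(1)[OF tc])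
  show "P d (\<lambda>v. y (c (t v)))" by (rule 1(2)[OF c])
  show "P d (\<lambda>v. y (c (c (t v))))" by (rule 1(2)[OF cc])
qed

lemma degree_alt:
  assumes "P d y"
  shows "P d (alt y)"
proof -
  note comp = degree_comp[OF assms]
  show ?thesis
    unfolding alt_def[abs_def]
    by (intro filtration_add[OF filtr] filtration_diff[OF filtr] comp assms)
qed

lemma degree_chi:
  assumes "P d f"
  shows "P d (chi0 f)" "P d (chi1 f)" "P d (chi2 f)" "P d (chi3 f)"
proof -
  note comp = degree_klein[OF assms]
  show "P d (chi0 f)" "P d (chi1 f)" "P d (chi2 f)" "P d (chi3 f)"
    unfolding chi0_def[abs_def] chi1_def[abs_def] chi2_def[abs_def] chi3_def[abs_def]
    by (intro filtration_add[OF filtr] filtration_diff[OF filtr] comp assms)+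
qed

lemma degree_xi:
  assumes "P d y"
  shows "coeffwise P d (xi y)"
proof -
  note comp = degree_comp[OF assms]
  show ?thesis
    unfolding xi_def[abs_def]
    by (intro filtration_add[OF filtr] coeffwise_pCons[OF filtr] coeffwise_const[OF filtr] comp assms)
qed

lemma degree_const_poly: "P d y \<Longrightarrow> coeffwise P d (\<lambda>v. [:y v:])"
  by (intro coeffwise_pCons[OF filtr] coeffwise_const[OF filtr])

text \<open>The coefficient \<open>chi0 f\<close> has degree 1 and is counted with degree 2, like
  the squares beside it.\<close>

lemma degree_quad:
  assumes "P 1 f"
  shows "coeffwise P 2 (quad f)"
proof -
  note chi = degree_chi[OF assms]
  have "P 2 (chi0 f)" "P 2 (\<lambda>v. (chi1 f v)\<^sup>2)" "P 2 (\<lambda>v. (chi2 f v)\<^sup>2)" "P 2 (\<lambda>v. (chi3 f v)\<^sup>2)"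
    using filtration_mono[OF filtr, OF chi(1), of 2] filtration_power[OF filtr, OF chi(2), of 2 2]
      filtration_power[OF filtr, OF chi(3), of 2 2] filtration_power[OF filtr, OF chi(4), of 2 2] by simp_all
  then show ?thesis
    unfolding quad_def[abs_def]
    by (intro coeffwise_pCons[OF filtr] coeffwise_const[OF filtr])
qed

lemma degree_cub:
  assumes "P 1 f"
  shows "P 3 (cub f)"
proof -
  note chi = degree_chi[OF assms]
  have "P 2 (\<lambda>v. chi1 f v * chi2 f v)"
    using filtration_mult[OF filtr, OF chi(2,3), of 2] by simp
  from filtration_mult[OF filtr, OF this chi(4), of 3] show ?thesis
    by (simp add: cub_def[abs_def])
qed

end

end

section \<open>Combining both separations: the bound 9\<close>

context s4_action
begin

lemma klein_invariant_comp:
  assumes "\<And>x. x \<in> X \<Longrightarrow> y (a x) = y x" "\<And>x. x \<in> X \<Longrightarrow> y (b x) = y x" "x \<in> X"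
  shows "xi y (a x) = xi y x" "xi y (b x) = xi y x" "alt y (a x) = alt y x" "alt y (b x) = alt y x"
    "xi y (c (a x)) = xi y (c x)" "xi y (c (b x)) = xi y (c x)"
    "xi y (c (c (a x))) = xi y (c (c x))" "xi y (c (c (b x))) = xi y (c (c x))"
  using assms by (simp_all add: xi_def alt_def)

text \<open>The stable set \<open>Q\<close> stands for the orbit of \<open>v\<close>. The bound 9 is
  6 + 3, for a product of three factors of degree 2 (each linear in \<open>y\<close>) and
  \<open>cub f\<close> of degree 3; all other functions tested have degree at most 8.\<close>

theorem same_orbit_if_same_moments:
  fixes P :: "nat \<Rightarrow> ('v \<Rightarrow> 'k::idom) \<Rightarrow> bool" and f :: "'v \<Rightarrow> 'k"
  assumes P: "equivariant_filtration P" and f: "P 1 f" "inj_on f X"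
    and char: "(2::'k) \<noteq> 0" "(3::'k) \<noteq> 0"
    and X: "v \<in> X" "w \<in> X" and moments: "same_moments P v w"
    and Q: "v \<in> Q" "\<And>x. x \<in> Q \<Longrightarrow> a x \<in> Q \<and> b x \<in> Q \<and> c x \<in> Q \<and> t x \<in> Q"
  shows "w \<in> Q"
proof (rule ccontr)
  assume notQ: "w \<notin> Q"
  define y where "y = quad f"
  \<comment> \<open>As \<open>y = quad f\<close> is already polynomial valued, \<open>xi y\<close>
    takes values in polynomials over polynomials; \<open>cub f\<close> is embedded there as a
    constant.\<close>
  define R where "R x = [:[:cub f x:]:]" for x
  have char': "(2::'k poly) \<noteq> 0" "(3::'k poly) \<noteq> 0" "(2::'k poly poly) \<noteq> 0"
    using char by (simp_all add: numeral_poly)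
  note P1 = equivariant_filtration_coeffwise[OF P]
  note P2 = equivariant_filtration_coeffwise[OF P1]
  note fP2 = filtr[OF P2]
  note y1 = degree_quad[OF P f(1), folded y_def]
  note dxi = degree_xi[OF P1 y1]
  note dalt = degree_const_poly[OF P1 degree_alt[OF P1 y1]]
  have dR: "coeffwise (coeffwise P) 3 R"
    unfolding R_def[abs_def] by (rule degree_const_poly[OF P1 degree_const_poly[OF P degree_cub[OF P f(1)]]])
  have yinv: "y (a x) = y x" "y (b x) = y x" if "x \<in> X" for x
    using that by (simp_all add: y_def)
  note inv = klein_invariant_comp[of y, OF yinv]
  have inv_vdm: "vdm (xi y) (a x) = vdm (xi y) x" "vdm (xi y) (b x) = vdm (xi y) x" if "x \<in> X" for x
    using that by (simp_all only: vdm_def inv)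
  have Rinv: "R (a x) = R x" "R (b x) = R x" if "x \<in> X" for x
    using that by (simp_all add: R_def)
  have mom1: "S F v = S F w" if "coeffwise P 9 F" "\<And>x. x \<in> X \<Longrightarrow> F (a x) = F x"
    "\<And>x. x \<in> X \<Longrightarrow> F (b x) = F x" for F
    using same_moments_coeffwise[OF moments] that unfolding same_moments_def by blast
  have mom2: "S F v = S F w" if "coeffwise (coeffwise P) n F" "n \<le> 9"
    "\<And>x. x \<in> X \<Longrightarrow> F (a x) = F x" "\<And>x. x \<in> X \<Longrightarrow> F (b x) = F x" for F n
    using same_moments_coeffwise[OF same_moments_coeffwise[OF moments]]
      filtration_mono[OF fP2, OF that(1,2)] that(3,4) unfolding same_moments_def by blast
  have dvdm: "coeffwise (coeffwise P) 6 (vdm (xi y))"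
  proof -
    note cs = dxi degree_comp[OF P2 dxi]
    note d = filtration_diff[OF fP2, OF cs(1) cs(2)] filtration_diff[OF fP2, OF cs(1) cs(4)]
      filtration_diff[OF fP2, OF cs(2) cs(4)]
    from filtration_mult[OF fP2, OF filtration_mult[OF fP2, OF d(1) d(2), of 4] d(3), of 6]
    show ?thesis by (simp add: vdm_def[abs_def])
  qed
  have "\<exists>u \<in> orb v. same y u w"
  proof (rule orbit_separation[OF char'(1,2) X])
    show "S (xi y) v = S (xi y) w"
      by (rule mom2[OF dxi]) (simp_all add: inv)
    show "S (\<lambda>x. (xi y x)\<^sup>2) v = S (\<lambda>x. (xi y x)\<^sup>2) w"
      by (rule mom2[OF filtration_power[OF fP2, OF dxi, of 2 4]]) (simp_all add: inv)
    show "S (\<lambda>x. xi y x ^ 3) v = S (\<lambda>x. xi y x ^ 3) w"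
      by (rule mom2[OF filtration_power[OF fP2, OF dxi, of 3 6]]) (simp_all add: inv)
    show "S (\<lambda>x. (alt y x)\<^sup>2) v = S (\<lambda>x. (alt y x)\<^sup>2) w"
      by (rule mom1[OF filtration_power[OF filtr[OF P1], OF degree_alt[OF P1 y1], of 2 9]]) (simp_all add: inv)
    show "S (\<lambda>x. [:alt y x:] * vdm (xi y) x) v = S (\<lambda>x. [:alt y x:] * vdm (xi y) x) w"
      by (rule mom2[OF filtration_mult[OF fP2, OF dalt dvdm, of 8]]) (simp_all add: inv inv_vdm)
  qed
  then obtain u where u: "u \<in> orb v" "same y u w" by blast
  have uX: "u \<in> X" using orb_closed[OF X(1) u(1)] .
  have orbQ: "z' \<in> Q" if "z \<in> Q" "z' \<in> orb z" for z z'
    using that Q(2) by (auto simp: orb_def)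
  have uQ: "u \<in> Q" using orbQ[OF Q(1) u(1)] .
  have wQ: "z \<notin> Q" if "z \<in> orb w" for z
  proof
    assume "z \<in> Q"
    moreover have "w \<in> orb z"
      using that X(2) by (auto simp: orb_def)
    ultimately show False using orbQ notQ by blast
  qed
  \<comment> \<open>If \<open>cub f\<close> agreed as well, then \<open>klein_orbit\<close> would
    put \<open>z'\<close> into \<open>Q\<close>. So the values are opposite and distinct, hence
    nonzero.\<close>
  have klein: "cub f z = - cub f z' \<and> cub f z \<noteq> 0"
    if "z \<in> Q" "z' \<notin> Q" "z \<in> X" "z' \<in> X" "y z = y z'" for z z'
  proof -
    have "cub f z \<noteq> cub f z'"
    proof
      assume "cub f z = cub f z'"
      from klein_orbit[OF char(1) f(2) that(3,4) that(5)[unfolded y_def] this]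
      have "z' \<in> Q" using that(1) Q(2) by blast
      with that show False by simp
    qed
    with cub_eq_or_neg[OF that(5)[unfolded y_def]] show ?thesis by auto
  qed
  have pair: "\<exists>z'. z' \<in> orb w \<and> y z = y z'" if "z \<in> orb u" for z
    using that u(2) by (auto simp: orb_def same_def)
  have R_neg: "R z' = - R z" if "z \<in> orb u" "z' \<in> orb w" "y z = y z'" for z z'
    using klein[OF orbQ[OF uQ that(1)] wQ[OF that(2)] orb_closed[OF uX that(1)]
        orb_closed[OF X(2) that(2)] that(3)] by (simp add: R_def)
  have Sv: "S F v = S F u" for F :: "'v \<Rightarrow> 'k poly poly"
    using u(1) X by (auto simp: orb_def S_def ac_simps)
  have dbl: "z = 0" if "z + z = 0" for z :: "'k poly poly"
    using char'(3) that by (metis mult_2 mult_eq_0_iff)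
  have S0: "S (\<lambda>x. H (xi y x) (xi y (c x)) (alt y x) * R x) u = 0"
    if H: "coeffwise (coeffwise P) 6 (\<lambda>x. H (xi y x) (xi y (c x)) (alt y x))" for H
  proof -
    define h where "h x = H (xi y x) (xi y (c x)) (alt y x)" for x
    have hsame: "h z = h z'" if "same y z z'" "z \<in> X" "z' \<in> X" for z z'
    proof -
      have "xi y z = xi y z'" "xi y (c z) = xi y (c z')" "alt y z = alt y z'"
        using that by (simp_all add: same_def xi_def alt_def)
      then show ?thesis by (simp add: h_def)
    qed
    have hR: "h z' * R z' = - (h z * R z)" if "same y z z'" "z \<in> orb u" "z' \<in> orb w" for z z'
    proof -
      have "y z = y z'" using that(1) by (simp add: same_def)
      with R_neg[OF that(2,3)] hsame[OF that(1) orb_closed[OF uX that(2)] orb_closed[OF X(2) that(3)]]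
      show ?thesis by simp
    qed
    \<comment> \<open>At matching points of the two orbits \<open>h\<close> agrees and
      \<open>R\<close> is opposite. So the sums are opposite, while the moments in degree 6 + 3 make
      them equal; both vanish.\<close>
    have "S (\<lambda>x. h x * R x) w = - S (\<lambda>x. h x * R x) u"
    proof -
      have "h w * R w = - (h u * R u)" "h (c w) * R (c w) = - (h (c u) * R (c u))"
        "h (c (c w)) * R (c (c w)) = - (h (c (c u)) * R (c (c u)))"
        "h (t w) * R (t w) = - (h (t u) * R (t u))"
        "h (t (c w)) * R (t (c w)) = - (h (t (c u)) * R (t (c u)))"
        "h (t (c (c w))) * R (t (c (c w))) = - (h (t (c (c u))) * R (t (c (c u))))"
        by (rule hR; use u(2) uX X(2) in \<open>simp add: orb_def same_def\<close>)+
      then show ?thesis by (simp add: S_def)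
    qed
    moreover have "S (\<lambda>x. h x * R x) v = S (\<lambda>x. h x * R x) w"
      by (rule mom2[OF filtration_mult[OF fP2, OF H[folded h_def] dR, of 9]])
        (simp_all add: h_def inv Rinv)
    ultimately have "S (\<lambda>x. h x * R x) u + S (\<lambda>x. h x * R x) u = 0"
      unfolding Sv by (metis add.left_inverse)
    then have "S (\<lambda>x. h x * R x) u = 0"
      by (rule dbl)
    then show ?thesis
      by (simp only: h_def)
  qed
  note dxi_diff = filtration_diff[OF fP2, OF dxi filtration_const[OF fP2]]
  note dxic_diff = filtration_diff[OF fP2, OF degree_comp(1)[OF P2 dxi] filtration_const[OF fP2]]
  note dalt_diff = filtration_diff[OF fP2, OF dalt filtration_const[OF fP2]]
  show False
  proof (rule twisted_sum_nonzero[OF char'(1,2) uX, of y R])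
    \<comment> \<open>Both values are the negative of \<open>R x\<close> at one point
      \<open>x\<close> of the orbit of \<open>w\<close> with the same value of
      \<open>y\<close>.\<close>
    show "R z = R z'" if z: "z \<in> orb u" "z' \<in> orb u" "same y z z'" for z z'
    proof -
      obtain x where x: "x \<in> orb w" "y z' = y x" using pair[OF z(2)] by blast
      have "y z = y x" using x z(3) by (simp add: same_def)
      from R_neg[OF z(1) x(1) this] R_neg[OF z(2) x] show ?thesis by simp
    qed
    show "R z \<noteq> 0" if z: "z \<in> orb u" for z
    proof -
      obtain x where x: "x \<in> orb w" "y z = y x" using pair[OF z] by blast
      show ?thesis
        using klein[OF orbQ[OF uQ z] wQ[OF x(1)] orb_closed[OF uX z] orb_closed[OF X(2) x(1)] x(2)]
        by (auto simp: R_def)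
    qed
    show "S (\<lambda>x. (xi y x - p) * (xi y x - q) * (xi y (c x) - s) * R x) u = 0" for p q s
      by (rule S0[of "\<lambda>k l e. (k - p) * (k - q) * (l - s)",
            OF filtration_mult[OF fP2, OF filtration_mult[OF fP2, OF dxi_diff dxi_diff, of 4] dxic_diff]])
        simp_all
    show "S (\<lambda>x. ([:alt y x:] - p) * (xi y x - q) * R x) u = 0" for p q
      by (rule S0[of "\<lambda>k l e. ([:e:] - p) * (k - q)", OF filtration_mult[OF fP2, OF dalt_diff dxi_diff]])
        simp
    show "S (\<lambda>x. (xi y x - q) * R x) u = 0" for q
      by (rule S0[of "\<lambda>k l e. k - q", OF filtration_mono[OF fP2, OF dxi_diff]]) simp
    show "S (\<lambda>x. ([:alt y x:] - p) * R x) u = 0" for p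
      by (rule S0[of "\<lambda>k l e. [:e:] - p", OF filtration_mono[OF fP2, OF dalt_diff]]) simp
    show "S R u = 0"
      using S0[of "\<lambda>k l e. 1", OF filtration_const[OF fP2]] by simp
  qed
qed

end

section \<open>Polynomials of bounded degree\<close>

text \<open>The bound is imposed monomial by monomial, which suits sums and products better than the
  maximum in \<open>total_degree\<close>.\<close>

definition mpolys :: "nat \<Rightarrow> nat \<Rightarrow> 'k::field mpoly set" where
  "mpolys n d = {f. \<forall>m \<in> Poly_Mapping.keys f. Poly_Mapping.keys m \<subseteq> {..<n} \<and> monom_degree m \<le> d}"

lemma mpolys_eq: "mpolys n d = {f \<in> mpoly_carrier n. total_degree f \<le> d}"
  by (auto simp: mpolys_def mpoly_carrier_def total_degree_def)

lemma monom_degree_superset: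
  assumes "finite A" "Poly_Mapping.keys m \<subseteq> A"
  shows "monom_degree m = (\<Sum>i\<in>A. Poly_Mapping.lookup m i)"
  unfolding monom_degree_def
  by (rule sum.mono_neutral_left) (use assms in \<open>auto simp: in_keys_iff\<close>)

lemma monom_degree_add: "monom_degree (m + m') = monom_degree m + monom_degree m'"
proof -
  let ?A = "Poly_Mapping.keys m \<union> Poly_Mapping.keys m'"
  show ?thesis
    using monom_degree_superset[of ?A m] monom_degree_superset[of ?A m']
      monom_degree_superset[of ?A "m + m'"] Poly_Mapping.keys_add[of m m']
    by (simp add: lookup_add sum.distrib)
qed

lemma mpolys_mono: "f \<in> mpolys n d \<Longrightarrow> d \<le> e \<Longrightarrow> f \<in> mpolys n e"
  by (auto simp: mpolys_def)

lemma mpolys_const: "mpoly_const k \<in> mpolys n d"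
  by (auto simp: mpolys_def mpoly_const_def monom_degree_def)

lemma mpolys_zero: "0 \<in> mpolys n d"
  by (simp add: mpolys_def)

lemma mpolys_var: "i < n \<Longrightarrow> mpoly_var i \<in> mpolys n (Suc 0)"
  by (auto simp: mpolys_def mpoly_var_def monom_degree_def)

lemma mpolys_add: "f \<in> mpolys n d \<Longrightarrow> g \<in> mpolys n d \<Longrightarrow> f + g \<in> mpolys n d"
  using Poly_Mapping.keys_add[of f g] by (auto simp: mpolys_def)

lemma mpolys_mult:
  assumes "f \<in> mpolys n d" "g \<in> mpolys n e"
  shows "f * g \<in> mpolys n (d + e)"
  unfolding mpolys_def
proof (safe, goal_cases)
  case (1 m i)
  then obtain p q where "m = p + q" "p \<in> Poly_Mapping.keys f" "q \<in> Poly_Mapping.keys g"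
    using keys_mult[of f g] by auto
  moreover have "i \<in> Poly_Mapping.keys p \<or> i \<in> Poly_Mapping.keys q"
    using 1(2) \<open>m = p + q\<close> Poly_Mapping.keys_add[of p q] by blast
  ultimately show ?case
    using assms by (auto simp: mpolys_def)
next
  case (2 m)
  then obtain p q where "m = p + q" "p \<in> Poly_Mapping.keys f" "q \<in> Poly_Mapping.keys g"
    using keys_mult[of f g] by auto
  with assms show ?case
    by (auto simp: mpolys_def monom_degree_add add_mono)
qed

lemma mpolys_sum: "(\<And>i. i \<in> A \<Longrightarrow> f i \<in> mpolys n d) \<Longrightarrow> (\<Sum>i\<in>A. f i) \<in> mpolys n d"
  by (induction A rule: infinite_finite_induct) (simp_all add: mpolys_zero mpolys_add)

lemma mpoly_const_one: "mpoly_const 1 = 1"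
  by (simp add: mpoly_const_def)

lemma mpolys_power: "f \<in> mpolys n d \<Longrightarrow> f ^ k \<in> mpolys n (k * d)"
proof (induction k)
  case 0
  show ?case using mpolys_const[of 1] by (simp add: mpoly_const_one)
next
  case (Suc k)
  then show ?case using mpolys_mult[of f n d "f ^ k" "k * d"] by simp
qed

lemma mpolys_prod: "(\<And>i. i \<in> A \<Longrightarrow> f i \<in> mpolys n (d i)) \<Longrightarrow> (\<Prod>i\<in>A. f i) \<in> mpolys n (\<Sum>i\<in>A. d i)"
proof (induction A rule: infinite_finite_induct)
  case (insert x A)
  then show ?case using mpolys_mult[of "f x" n "d x" "prod f A" "sum d A"] by simp
qed (use mpolys_const[of 1] in \<open>simp_all add: mpoly_const_one\<close>)

lemma mpoly_const_add: "mpoly_const (k + l) = mpoly_const k + mpoly_const l"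
  by (simp add: mpoly_const_def single_add)

lemma mpoly_const_mult: "mpoly_const (k * l) = mpoly_const k * mpoly_const l"
  by (simp add: mpoly_const_def mult_single)

lemma mpoly_const_zero: "mpoly_const 0 = 0"
  by (simp add: mpoly_const_def)

lemma mpoly_const_sum: "mpoly_const (\<Sum>i\<in>A. k i) = (\<Sum>i\<in>A. mpoly_const (k i))"
  by (induction A rule: infinite_finite_induct) (simp_all add: mpoly_const_zero mpoly_const_add)

section \<open>Substitution as a ring homomorphism, and the group action by it\<close>

lemma mpoly_subst_add: "mpoly_subst s (f + g) = mpoly_subst s f + mpoly_subst s g"
proof -
  let ?A = "Poly_Mapping.keys f \<union> Poly_Mapping.keys g"
  have "Poly_Mapping.keys (f + g) \<subseteq> ?A"
    by (rule Poly_Mapping.keys_add)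
  then show ?thesis
    unfolding mpoly_subst_def
    by (simp add: mpoly_insert_superset[of ?A] mpoly_const_zero mpoly_const_add lookup_add
        distrib_right sum.distrib)
qed

lemma mpoly_subst_zero: "mpoly_subst s 0 = 0"
  by (simp add: mpoly_subst_def mpoly_insert_def)

lemma mpoly_subst_sum: "mpoly_subst s (\<Sum>x \<in> A. F x) = (\<Sum>x \<in> A. mpoly_subst s (F x))"
  by (induction A rule: infinite_finite_induct) (simp_all add: mpoly_subst_add mpoly_subst_zero)

lemma mpoly_subst_single:
  "mpoly_subst s (Poly_Mapping.single m k) =
     mpoly_const k * (\<Prod>i \<in> Poly_Mapping.keys m. s i ^ Poly_Mapping.lookup m i)"
  by (simp add: mpoly_subst_def mpoly_insert_def lookup_single mpoly_const_zero)

lemma mpoly_subst_mult: "mpoly_subst s (f * g) = mpoly_subst s f * mpoly_subst s g"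
proof -
  have "f * g =
      (\<Sum>m \<in> Poly_Mapping.keys f. \<Sum>m' \<in> Poly_Mapping.keys g.
         Poly_Mapping.single (m + m') (Poly_Mapping.lookup f m * Poly_Mapping.lookup g m'))"
    by (subst mpoly_sum_single[of f], subst mpoly_sum_single[of g])
      (simp add: sum_product mult_single)
  then show ?thesis
    by (simp add: mpoly_subst_sum mpoly_subst_single monom_eval_add mpoly_const_mult)
      (simp add: mpoly_subst_def mpoly_insert_def sum_product mult_ac)
qed

lemma mpoly_subst_const: "mpoly_subst s (mpoly_const k) = mpoly_const k"
  by (simp add: mpoly_const_def[of k] mpoly_subst_single)

lemma mpoly_subst_var: "mpoly_subst s (mpoly_var i) = s i"
  by (simp add: mpoly_var_def mpoly_subst_single mpoly_const_one)

lemma mpoly_subst_power: "mpoly_subst s (f ^ k) = mpoly_subst s f ^ k"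
  using mpoly_subst_const[of s 1]
  by (induction k) (simp_all add: mpoly_subst_mult mpoly_const_one)

lemma mpoly_subst_prod: "mpoly_subst s (\<Prod>x \<in> A. F x) = (\<Prod>x \<in> A. mpoly_subst s (F x))"
  using mpoly_subst_const[of s 1]
  by (induction A rule: infinite_finite_induct) (simp_all add: mpoly_subst_mult mpoly_const_one)

lemma mpoly_subst_mpoly_subst:
  "mpoly_subst s (mpoly_subst r f) = mpoly_subst (\<lambda>i. mpoly_subst s (r i)) f"
  unfolding mpoly_subst_def[of r f] mpoly_subst_def[of _ f] mpoly_insert_def
  by (simp add: mpoly_subst_sum mpoly_subst_mult mpoly_subst_prod mpoly_subst_power mpoly_subst_const)

lemma mpoly_subst_cong:
  assumes "f \<in> mpoly_carrier n" "\<And>i. i < n \<Longrightarrow> s i = r i"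
  shows "mpoly_subst s f = mpoly_subst r f"
  unfolding mpoly_subst_def mpoly_insert_def
proof (intro sum.cong prod.cong arg_cong2[of _ _ _ _ "(*)"] refl)
  fix m i assume "m \<in> Poly_Mapping.keys f" "i \<in> Poly_Mapping.keys m"
  then have "i < n" using assms(1) by (auto simp: mpoly_carrier_def)
  then show "s i ^ Poly_Mapping.lookup m i = r i ^ Poly_Mapping.lookup m i"
    using assms(2) by simp
qed

lemma mpoly_subst_closed:
  assumes f: "f \<in> mpolys n d" and s: "\<And>i. i < n \<Longrightarrow> s i \<in> mpolys n (Suc 0)"
  shows "mpoly_subst s f \<in> mpolys n d"
  unfolding mpoly_subst_def mpoly_insert_def
proof (rule mpolys_sum)
  fix m assume m: "m \<in> Poly_Mapping.keys f"
  have "(\<Prod>i\<in>Poly_Mapping.keys m. s i ^ Poly_Mapping.lookup m i) \<in> mpolys n (monom_degree m)"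
    unfolding monom_degree_def
  proof (rule mpolys_prod)
    fix i assume "i \<in> Poly_Mapping.keys m"
    then have "i < n" using m f by (auto simp: mpolys_def)
    then show "s i ^ Poly_Mapping.lookup m i \<in> mpolys n (Poly_Mapping.lookup m i)"
      using mpolys_power[OF s, of i "Poly_Mapping.lookup m i"] by simp
  qed
  from mpolys_mult[OF mpolys_const[of _ _ 0] this]
  have "mpoly_const (Poly_Mapping.lookup f m) * (\<Prod>i\<in>Poly_Mapping.keys m. s i ^ Poly_Mapping.lookup m i)
      \<in> mpolys n (monom_degree m)"
    by simp
  then show "mpoly_const (Poly_Mapping.lookup f m) * (\<Prod>i\<in>Poly_Mapping.keys m. s i ^ Poly_Mapping.lookup m i)
      \<in> mpolys n d"
    by (rule mpolys_mono) (use m f in \<open>auto simp: mpolys_def\<close>)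
qed

lemma KG_act_closed: "f \<in> mpolys n d \<Longrightarrow> KG_act G n \<rho> g f \<in> mpolys n d"
  unfolding KG_act_def
proof (rule mpoly_subst_closed)
  show "(\<Sum>j<n. mpoly_const (\<rho> (inv\<^bsub>G\<^esub> g) $$ (i, j)) * mpoly_var j) \<in> mpolys n (Suc 0)" for i
    by (rule mpolys_sum) (use mpolys_mult[OF mpolys_const[of _ _ 0] mpolys_var] in simp)
qed

text \<open>The inverse in \<open>KG_act\<close> makes up for the contravariance of substitution.
  The identity is one of formal polynomials, which evaluation at points could not prove over a
  finite field.\<close>

lemma KG_act_mult:
  assumes "group G" "KG_module G n \<rho>" "g \<in> carrier G" "h \<in> carrier G" "f \<in> mpoly_carrier n"
  shows "KG_act G n \<rho> g (KG_act G n \<rho> h f) = KG_act G n \<rho> (g \<otimes>\<^bsub>G\<^esub> h) f"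
proof -
  interpret group G by fact
  have dim: "\<rho> (inv\<^bsub>G\<^esub> g) \<in> carrier_mat n n" "\<rho> (inv\<^bsub>G\<^esub> h) \<in> carrier_mat n n"
    using assms by (simp_all add: KG_module_def)
  have "\<rho> (inv\<^bsub>G\<^esub> (g \<otimes>\<^bsub>G\<^esub> h)) = \<rho> (inv\<^bsub>G\<^esub> h) * \<rho> (inv\<^bsub>G\<^esub> g)"
    using assms by (simp add: inv_mult_group KG_module_def)
  then have coord: "\<rho> (inv\<^bsub>G\<^esub> (g \<otimes>\<^bsub>G\<^esub> h)) $$ (i, k) =
      (\<Sum>j<n. \<rho> (inv\<^bsub>G\<^esub> h) $$ (i, j) * \<rho> (inv\<^bsub>G\<^esub> g) $$ (j, k))" if "i < n" "k < n" for i k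
    using dim that by (simp add: scalar_prod_def lessThan_atLeast0)
  show ?thesis
    unfolding KG_act_def mpoly_subst_mpoly_subst
  proof (rule mpoly_subst_cong[OF assms(5)])
    fix i assume i: "i < n"
    have "mpoly_subst (\<lambda>i. \<Sum>j<n. mpoly_const (\<rho> (inv\<^bsub>G\<^esub> g) $$ (i, j)) * mpoly_var j)
        (\<Sum>j<n. mpoly_const (\<rho> (inv\<^bsub>G\<^esub> h) $$ (i, j)) * mpoly_var j) =
      (\<Sum>j<n. \<Sum>k<n. mpoly_const (\<rho> (inv\<^bsub>G\<^esub> h) $$ (i, j)) *
        (mpoly_const (\<rho> (inv\<^bsub>G\<^esub> g) $$ (j, k)) * mpoly_var k))"
      by (simp add: mpoly_subst_sum mpoly_subst_mult mpoly_subst_const mpoly_subst_var sum_distrib_left)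
    also have "\<dots> = (\<Sum>k<n. \<Sum>j<n. mpoly_const (\<rho> (inv\<^bsub>G\<^esub> h) $$ (i, j)) *
        (mpoly_const (\<rho> (inv\<^bsub>G\<^esub> g) $$ (j, k)) * mpoly_var k))"
      by (rule sum.swap)
    also have "\<dots> = (\<Sum>k<n. mpoly_const (\<rho> (inv\<^bsub>G\<^esub> (g \<otimes>\<^bsub>G\<^esub> h)) $$ (i, k)) * mpoly_var k)"
      using i by (intro sum.cong)
        (simp_all add: coord mpoly_const_sum mpoly_const_mult sum_distrib_right mult.assoc)
    finally show "mpoly_subst (\<lambda>i. \<Sum>j<n. mpoly_const (\<rho> (inv\<^bsub>G\<^esub> g) $$ (i, j)) * mpoly_var j)
        (\<Sum>j<n. mpoly_const (\<rho> (inv\<^bsub>G\<^esub> h) $$ (i, j)) * mpoly_var j) =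
      (\<Sum>k<n. mpoly_const (\<rho> (inv\<^bsub>G\<^esub> (g \<otimes>\<^bsub>G\<^esub> h)) $$ (i, k)) * mpoly_var k)" .
  qed
qed

text \<open>The transfer, that is, the Reynolds operator without division by the group
  order.\<close>

definition KG_trace :: "('g, 'b) monoid_scheme \<Rightarrow> nat \<Rightarrow> ('g \<Rightarrow> 'k::field mat) \<Rightarrow> 'k mpoly \<Rightarrow> 'k mpoly" where
  "KG_trace G n \<rho> f = (\<Sum>g \<in> carrier G. KG_act G n \<rho> g f)"

lemma KG_trace_invariant:
  assumes "group G" "KG_module G n \<rho>" "f \<in> mpolys n d"
  shows "KG_trace G n \<rho> f \<in> {f \<in> KG_invariants G n \<rho>. total_degree f \<le> d}"
proof -
  interpret group G by fact
  have f: "f \<in> mpoly_carrier n" using assms(3) by (simp add: mpolys_eq)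
  have "KG_trace G n \<rho> f \<in> mpolys n d"
    unfolding KG_trace_def by (intro mpolys_sum KG_act_closed assms)
  moreover have "KG_act G n \<rho> h (KG_trace G n \<rho> f) = KG_trace G n \<rho> f" if h: "h \<in> carrier G" for h
  proof -
    have "KG_act G n \<rho> h (KG_trace G n \<rho> f) = (\<Sum>g\<in>carrier G. KG_act G n \<rho> h (KG_act G n \<rho> g f))"
      unfolding KG_trace_def KG_act_def[of _ _ _ h] by (simp add: mpoly_subst_sum)
    also have "\<dots> = (\<Sum>g\<in>carrier G. KG_act G n \<rho> (h \<otimes>\<^bsub>G\<^esub> g) f)"
      using KG_act_mult[OF assms(1,2) h _ f] by simp
    also have "\<dots> = KG_trace G n \<rho> f"
      unfolding KG_trace_def
      by (rule sum.reindex_bij_witness[of _ "\<lambda>g. inv\<^bsub>G\<^esub> h \<otimes>\<^bsub>G\<^esub> g" "\<lambda>g. h \<otimes>\<^bsub>G\<^esub> g"])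
        (use h in \<open>auto simp: m_assoc[symmetric]\<close>)
    finally show ?thesis .
  qed
  ultimately show ?thesis
    by (auto simp: mpolys_eq KG_invariants_def)
qed

lemma mpoly_eval_KG_trace:
  assumes "group G" "KG_module G n \<rho>" "f \<in> mpoly_carrier n" "v \<in> carrier_vec n"
  shows "mpoly_eval (KG_trace G n \<rho> f) v = (\<Sum>g \<in> carrier G. mpoly_eval f (\<rho> g *\<^sub>v v))"
proof -
  interpret group G by fact
  have "mpoly_eval (KG_trace G n \<rho> f) v = (\<Sum>g \<in> carrier G. mpoly_eval f (\<rho> (inv\<^bsub>G\<^esub> g) *\<^sub>v v))"
    unfolding KG_trace_def mpoly_eval_sum
    by (intro sum.cong refl mpoly_eval_KG_act assms)
  also have "\<dots> = (\<Sum>g \<in> carrier G. mpoly_eval f (\<rho> g *\<^sub>v v))"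
    by (rule sum.reindex_bij_witness[of _ "m_inv G" "m_inv G"]) auto
  finally show ?thesis .
qed

text \<open>A representing polynomial is only asked to exist, since over a finite field the function
  does not determine it. Values outside \<open>carrier_vec n\<close> do not matter.\<close>

definition poly_fun :: "nat \<Rightarrow> nat \<Rightarrow> ('k::field vec \<Rightarrow> 'k) \<Rightarrow> bool" where
  "poly_fun n d F \<longleftrightarrow> (\<exists>f \<in> mpolys n d. \<forall>v \<in> carrier_vec n. F v = mpoly_eval f v)"

lemma filtration_poly_fun: "filtration (poly_fun n)"
  unfolding filtration_def
proof (intro conjI allI impI)
  show "poly_fun n d (\<lambda>_. k)" for d and k :: 'a
    unfolding poly_fun_def by (rule bexI[of _ "mpoly_const k"]) (simp_all add: mpolys_const)
next
  fix d and F G :: "'a vec \<Rightarrow> 'a"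
  assume "poly_fun n d F" "poly_fun n d G"
  then obtain f g where "f \<in> mpolys n d" "g \<in> mpolys n d" "\<forall>v\<in>carrier_vec n. F v = mpoly_eval f v"
    "\<forall>v\<in>carrier_vec n. G v = mpoly_eval g v"
    by (auto simp: poly_fun_def)
  then show "poly_fun n d (\<lambda>v. F v + G v)"
    unfolding poly_fun_def by (intro bexI[of _ "f + g"]) (simp_all add: mpoly_eval_add mpolys_add)
next
  fix d e and F G :: "'a vec \<Rightarrow> 'a"
  assume "poly_fun n d F" "poly_fun n e G"
  then obtain f g where "f \<in> mpolys n d" "g \<in> mpolys n e" "\<forall>v\<in>carrier_vec n. F v = mpoly_eval f v"
    "\<forall>v\<in>carrier_vec n. G v = mpoly_eval g v"
    by (auto simp: poly_fun_def)
  then show "poly_fun n (d + e) (\<lambda>v. F v * G v)"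
    unfolding poly_fun_def by (intro bexI[of _ "f * g"]) (simp_all add: mpoly_eval_mult mpolys_mult)
next
  show "poly_fun n e F" if "poly_fun n d F" "d \<le> e" for d e and F :: "'a vec \<Rightarrow> 'a"
    using that(1) mpolys_mono[OF _ that(2)] unfolding poly_fun_def by blast
qed

lemma poly_fun_KG:
  assumes "group G" "KG_module G n \<rho>" "g \<in> carrier G" "poly_fun n d F"
  shows "poly_fun n d (\<lambda>v. F (\<rho> g *\<^sub>v v))"
proof -
  interpret group G by fact
  obtain f where f: "f \<in> mpolys n d" "\<forall>v\<in>carrier_vec n. F v = mpoly_eval f v"
    using assms(4) by (auto simp: poly_fun_def)
  have dim: "\<rho> g \<in> carrier_mat n n" using assms by (simp add: KG_module_def)
  have "F (\<rho> g *\<^sub>v v) = mpoly_eval (KG_act G n \<rho> (inv\<^bsub>G\<^esub> g) f) v" if "v \<in> carrier_vec n" for v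
    using mpoly_eval_KG_act[OF assms(1,2), of "inv\<^bsub>G\<^esub> g" f v] f that assms(3) dim
    by (simp add: mpolys_eq)
  then show ?thesis
    unfolding poly_fun_def by (intro bexI[OF _ KG_act_closed[OF f(1)]] ballI)
qed

text \<open>An injective map into a domain whose coefficients have degree 1, as required of
  \<open>f\<close> in \<open>same_orbit_if_same_moments\<close>.\<close>

definition vec_poly :: "'k::field vec \<Rightarrow> 'k poly" where
  "vec_poly v = (\<Sum>i<dim_vec v. monom (v $ i) i)"

lemma coeff_vec_poly: "v \<in> carrier_vec n \<Longrightarrow> coeff (vec_poly v) i = (if i < n then v $ i else 0)"
  by (simp add: vec_poly_def coeff_sum)

lemma inj_on_vec_poly: "inj_on vec_poly (carrier_vec n)"
proof (rule inj_onI)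
  fix v w :: "'a vec"
  assume vw: "v \<in> carrier_vec n" "w \<in> carrier_vec n" "vec_poly v = vec_poly w"
  then have "v $ i = w $ i" if "i < n" for i
    using coeff_vec_poly[of v n i] coeff_vec_poly[of w n i] that by simp
  then show "v = w" using vw by (intro eq_vecI) auto
qed

lemma poly_fun_cong: "poly_fun n d F \<Longrightarrow> (\<And>v. v \<in> carrier_vec n \<Longrightarrow> F v = G v) \<Longrightarrow> poly_fun n d G"
  by (auto simp: poly_fun_def)

lemma coeffwise_vec_poly: "coeffwise (poly_fun n) (Suc 0) vec_poly"
  unfolding coeffwise_def
proof
  fix i
  show "poly_fun n (Suc 0) (\<lambda>v. coeff (vec_poly v) i)"
  proof (cases "i < n")
    case True
    then have "poly_fun n (Suc 0) (\<lambda>v. v $ i)"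
      unfolding poly_fun_def by (intro bexI[of _ "mpoly_var i"]) (simp_all add: mpolys_var)
    then show ?thesis
      by (rule poly_fun_cong) (simp add: coeff_vec_poly True)
  next
    case False
    have "poly_fun n (Suc 0) (\<lambda>v. 0)"
      by (rule filtration_const[OF filtration_poly_fun])
    then show ?thesis
      by (rule poly_fun_cong) (simp add: coeff_vec_poly False)
  qed
qed

section \<open>Degree 9 suffices\<close>

definition kl1 :: "nat \<Rightarrow> nat" where "kl1 = transpose 1 2 \<circ> transpose 3 4"
definition kl2 :: "nat \<Rightarrow> nat" where "kl2 = transpose 1 3 \<circ> transpose 2 4"
text \<open>The 3-cycle sending 1 to 2, 2 to 3 and 3 to 1.\<close>

definition cyc :: "nat \<Rightarrow> nat" where "cyc = transpose 1 2 \<circ> transpose 2 3"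
definition swp :: "nat \<Rightarrow> nat" where "swp = transpose 1 2"

lemmas perm_defs = kl1_def kl2_def cyc_def swp_def

lemma perms_in_S4:
  "kl1 \<in> carrier (sym_group 4)" "kl2 \<in> carrier (sym_group 4)"
  "cyc \<in> carrier (sym_group 4)" "swp \<in> carrier (sym_group 4)"
  unfolding sym_group_carrier perm_defs
  by (intro permutes_compose permutes_swap_id; simp)+

lemma perm_relations:
  "kl1 \<circ> kl1 = id" "kl2 \<circ> kl2 = id" "kl2 \<circ> kl1 = kl1 \<circ> kl2" "cyc \<circ> (cyc \<circ> cyc) = id"
  "swp \<circ> swp = id" "cyc \<circ> swp = swp \<circ> (cyc \<circ> cyc)" "cyc \<circ> kl1 = kl1 \<circ> (kl2 \<circ> cyc)"
  "cyc \<circ> kl2 = kl1 \<circ> cyc" "swp \<circ> kl1 = kl1 \<circ> swp" "swp \<circ> kl2 = kl1 \<circ> (kl2 \<circ> swp)"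
  by (auto simp: perm_defs fun_eq_iff transpose_def)

definition S3_list :: "(nat \<Rightarrow> nat) list" where
  "S3_list = [id, cyc, cyc \<circ> cyc, swp, swp \<circ> cyc, swp \<circ> (cyc \<circ> cyc)]"

definition S4_list :: "(nat \<Rightarrow> nat) list" where
  "S4_list = S3_list @ map ((\<circ>) kl1) S3_list @ map ((\<circ>) kl2) S3_list @ map ((\<circ>) (kl1 \<circ> kl2)) S3_list"

text \<open>The entries are told apart by their values at 1, ..., 4, and 24 distinct elements
  exhaust a group of order 24.\<close>

lemma S4_list: "distinct S4_list" "set S4_list = carrier (sym_group 4)"
proof -
  have "distinct (map (\<lambda>p. (p 1, p 2, p 3, p 4)) S4_list)"
    by (simp add: S4_list_def S3_list_def perm_defs transpose_def)
  then show d: "distinct S4_list"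
    by (simp add: distinct_map)
  have sub: "set S4_list \<subseteq> carrier (sym_group 4)"
    using perms_in_S4 by (auto simp: S4_list_def S3_list_def sym_group_carrier intro!: permutes_compose permutes_id)
  have "card (carrier (sym_group 4)) = 24"
    by (simp add: sym_group_def card_permutations eval_nat_numeral)
  moreover have "card (set S4_list) = 24"
    using distinct_card[OF d] by (simp add: S4_list_def S3_list_def)
  moreover have "finite (carrier (sym_group 4))"
    by (simp add: sym_group_def finite_permutations)
  ultimately show "set S4_list = carrier (sym_group 4)"
    using sub by (metis card_subset_eq)
qed

section \<open>Degree 9 for an arbitrary representation of S_4\<close>

context
  fixes \<rho> :: "(nat \<Rightarrow> nat) \<Rightarrow> 'k::field mat" and n :: nat
  assumes \<rho>: "KG_module (sym_group 4) n \<rho>"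
begin

lemma rep_closed: "g \<in> carrier (sym_group 4) \<Longrightarrow> v \<in> carrier_vec n \<Longrightarrow> \<rho> g *\<^sub>v v \<in> carrier_vec n"
  using \<rho> by (auto simp: KG_module_def intro: mult_mat_vec_carrier)

lemma rep_comp:
  assumes "g \<in> carrier (sym_group 4)" "h \<in> carrier (sym_group 4)" "v \<in> carrier_vec n"
  shows "\<rho> g *\<^sub>v (\<rho> h *\<^sub>v v) = \<rho> (g \<circ> h) *\<^sub>v v"
proof -
  have "\<rho> (g \<circ> h) = \<rho> g * \<rho> h" "\<rho> g \<in> carrier_mat n n" "\<rho> h \<in> carrier_mat n n"
    using \<rho> assms by (simp_all add: KG_module_def sym_group_mult)
  then show ?thesis using assms(3) by simp
qed

lemma rep_id: "v \<in> carrier_vec n \<Longrightarrow> \<rho> id *\<^sub>v v = v"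
  using \<rho> by (simp add: KG_module_def sym_group_one)

lemma comp_in_S4:
  "g \<in> carrier (sym_group 4) \<Longrightarrow> h \<in> carrier (sym_group 4) \<Longrightarrow> g \<circ> h \<in> carrier (sym_group 4)"
  by (simp add: sym_group_carrier permutes_compose)

lemmas rep_simps = rep_closed rep_comp comp_in_S4 perms_in_S4

lemma s4_action_rep:
  "s4_action (carrier_vec n) (\<lambda>v. \<rho> cyc *\<^sub>v v) (\<lambda>v. \<rho> swp *\<^sub>v v) (\<lambda>v. \<rho> kl1 *\<^sub>v v) (\<lambda>v. \<rho> kl2 *\<^sub>v v)"
  by unfold_locales (simp_all add: rep_simps perm_relations rep_id)

interpretation s4_action "carrier_vec n" "\<lambda>v. \<rho> cyc *\<^sub>v v" "\<lambda>v. \<rho> swp *\<^sub>v v" "\<lambda>v. \<rho> kl1 *\<^sub>v v" "\<lambda>v. \<rho> kl2 *\<^sub>v v"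
  by (rule s4_action_rep)

text \<open>Every group element is a Klein element after an element of \<open>S3_list\<close>, and
  \<open>F\<close> does not see the four Klein elements.\<close>

lemma sum_S4_eq:
  fixes F :: "'k vec \<Rightarrow> 'b::comm_ring_1"
  assumes F: "\<And>x. x \<in> carrier_vec n \<Longrightarrow> F (\<rho> kl1 *\<^sub>v x) = F x"
    "\<And>x. x \<in> carrier_vec n \<Longrightarrow> F (\<rho> kl2 *\<^sub>v x) = F x" and v: "v \<in> carrier_vec n"
  shows "(\<Sum>g\<in>carrier (sym_group 4). F (\<rho> g *\<^sub>v v)) = 4 * S F v"
proof -
  define T where "T = sum_list (map (\<lambda>q. F (\<rho> q *\<^sub>v v)) S3_list)"
  have S3: "q \<in> carrier (sym_group 4)" if "q \<in> set S3_list" for q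
    using that S4_list(2) by (auto simp: S4_list_def)
  have 1: "F (\<rho> (kl1 \<circ> q) *\<^sub>v v) = F (\<rho> q *\<^sub>v v)" "F (\<rho> (kl2 \<circ> q) *\<^sub>v v) = F (\<rho> q *\<^sub>v v)"
    if "q \<in> carrier (sym_group 4)" for q
    using F[of "\<rho> q *\<^sub>v v"] that v by (simp_all add: rep_simps)
  have 2: "F (\<rho> (kl1 \<circ> kl2 \<circ> q) *\<^sub>v v) = F (\<rho> q *\<^sub>v v)" if "q \<in> carrier (sym_group 4)" for q
    using 1(1)[OF comp_in_S4[OF perms_in_S4(2) that]] 1(2)[OF that] by (simp add: o_assoc)
  have "(\<Sum>g\<in>carrier (sym_group 4). F (\<rho> g *\<^sub>v v)) = sum_list (map (\<lambda>g. F (\<rho> g *\<^sub>v v)) S4_list)"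
    using S4_list by (simp add: sum_list_distinct_conv_sum_set)
  also have "\<dots> = T + T + T + T"
    using 1 2 S3 by (simp add: S4_list_def T_def comp_def[of "\<lambda>g. F (\<rho> g *\<^sub>v v)"] cong: map_cong)
  also have "T = S F v"
    using v by (simp add: T_def S3_list_def S_def rep_simps rep_id add_ac)
  finally show ?thesis by simp
qed

text \<open>Instance of \<open>same_orbit_if_same_moments\<close> over the domain
  \<open>'k poly\<close>, with degrees counted coefficientwise and the orbit of \<open>v\<close> as
  \<open>Q\<close>.\<close>

theorem separated_by_degree_9:
  assumes char: "(2::'k) \<noteq> 0" "(3::'k) \<noteq> 0"
    and v: "v \<in> carrier_vec n" and w: "w \<in> carrier_vec n"
    and eq: "\<And>f. f \<in> KG_invariants (sym_group 4) n \<rho> \<Longrightarrow> total_degree f \<le> 9 \<Longrightarrow> mpoly_eval f v = mpoly_eval f w"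
  shows "w \<in> KG_orbit (sym_group 4) \<rho> v"
proof (rule same_orbit_if_same_moments[of "coeffwise (poly_fun n)" vec_poly])
  note G = sym_group_is_group[of 4]
  have "equivariant_filtration (poly_fun n)"
    using poly_fun_KG[OF G \<rho>] perms_in_S4 by (simp add: equivariant_filtration_def filtration_poly_fun)
  then show "equivariant_filtration (coeffwise (poly_fun n))"
    by (rule equivariant_filtration_coeffwise)
  show "(2::'k poly) \<noteq> 0" "(3::'k poly) \<noteq> 0"
    using char by (simp_all add: numeral_poly)
  have "same_moments (poly_fun n) v w"
    unfolding same_moments_def
  proof (intro allI impI)
    fix F assume F: "poly_fun n 9 F"
      "\<forall>x\<in>carrier_vec n. F (\<rho> kl1 *\<^sub>v x) = F x \<and> F (\<rho> kl2 *\<^sub>v x) = F x"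
    then obtain f where f: "f \<in> mpolys n 9" "\<forall>v\<in>carrier_vec n. F v = mpoly_eval f v"
      by (auto simp: poly_fun_def)
    \<comment> \<open>Up to the factor 4, the moments are values of the transfer, which is an
      invariant of degree at most 9.\<close>
    have *: "4 * S F x = mpoly_eval (KG_trace (sym_group 4) n \<rho> f) x" if "x \<in> carrier_vec n" for x
    proof -
      have "4 * S F x = (\<Sum>g\<in>carrier (sym_group 4). F (\<rho> g *\<^sub>v x))"
        using F that by (simp add: sum_S4_eq)
      also have "\<dots> = (\<Sum>g\<in>carrier (sym_group 4). mpoly_eval f (\<rho> g *\<^sub>v x))"
        using f that by (intro sum.cong) (simp_all add: rep_closed)
      finally show ?thesis
        using mpoly_eval_KG_trace[OF G \<rho>, of f x] f that by (simp add: mpolys_eq)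
    qed
    have "4 * S F v = 4 * S F w"
      using KG_trace_invariant[OF G \<rho> f(1)] eq v w by (simp add: *)
    moreover have "(4::'k) \<noteq> 0"
      using char(1) by (metis mult_2 mult_eq_0_iff numeral_Bit0)
    ultimately show "S F v = S F w" by simp
  qed
  then show "same_moments (coeffwise (poly_fun n)) v w"
    by (rule same_moments_coeffwise)
  show "v \<in> KG_orbit (sym_group 4) \<rho> v"
    using rep_id[OF v] by (auto simp: KG_orbit_def sym_group_carrier intro!: exI[of _ id] permutes_id)
  show "\<rho> kl1 *\<^sub>v x \<in> KG_orbit (sym_group 4) \<rho> v \<and> \<rho> kl2 *\<^sub>v x \<in> KG_orbit (sym_group 4) \<rho> v \<and>
    \<rho> cyc *\<^sub>v x \<in> KG_orbit (sym_group 4) \<rho> v \<and> \<rho> swp *\<^sub>v x \<in> KG_orbit (sym_group 4) \<rho> v"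
    if "x \<in> KG_orbit (sym_group 4) \<rho> v" for x
    using that v by (auto simp: KG_orbit_def rep_comp perms_in_S4 intro!: exI comp_in_S4)
qed (use v w coeffwise_vec_poly inj_on_vec_poly in simp_all)

end

section \<open>Degree 8 does not suffice\<close>

text \<open>The determinant with entries \<open>V i ^ e k\<close>, rows and columns indexed by
  \<open>I\<close>, in Leibniz form; a generalised Vandermonde determinant.\<close>

definition alternant :: "'i set \<Rightarrow> ('i \<Rightarrow> 'k::comm_ring_1) \<Rightarrow> ('i \<Rightarrow> nat) \<Rightarrow> 'k" where
  "alternant I V e = (\<Sum>p | p permutes I. of_int (sign p) * (\<Prod>k\<in>I. V (p k) ^ e k))"

text \<open>Two columns are equal: composition with the transposition of \<open>i\<close> and
  \<open>j\<close> keeps each product and reverses its sign, so the alternant is its own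
  negative.\<close>

lemma alternant_eq_0_if_equal:
  fixes V :: "'i \<Rightarrow> 'k::idom"
  assumes "finite I" "i \<in> I" "j \<in> I" "i \<noteq> j" "e i = e j" "(2::'k) \<noteq> 0"
  shows "alternant I V e = 0"
proof -
  define s where "s = transpose i j"
  have s: "s permutes I" "s \<circ> s = id" "sign s = - 1" "e (s k) = e k" for k
    using assms by (auto simp: s_def permutes_swap_id sign_swap_id transpose_def)
  have "(\<Prod>k\<in>I. V (p (s k)) ^ e k) = (\<Prod>k\<in>I. V (p k) ^ e k)" for p
    using prod.permute[OF s(1), of "\<lambda>k. V (p k) ^ e k"] by (simp add: s comp_def)
  moreover have "permutation p" if "p permutes I" for p
    using that assms(1) permutation_permutes by blast
  ultimately have "of_int (sign (p \<circ> s)) * (\<Prod>k\<in>I. V ((p \<circ> s) k) ^ e k) =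
      - (of_int (sign p) * (\<Prod>k\<in>I. V (p k) ^ e k))" if "p permutes I" for p
    using that s by (simp add: sign_compose)
  moreover have "alternant I V e = (\<Sum>p | p permutes I. of_int (sign (p \<circ> s)) * (\<Prod>k\<in>I. V ((p \<circ> s) k) ^ e k))"
    unfolding alternant_def
    by (rule sum.reindex_bij_witness[of _ "\<lambda>p. p \<circ> s" "\<lambda>p. p \<circ> s"])
      (use s in \<open>auto simp: comp_assoc permutes_compose\<close>)
  ultimately have "alternant I V e = - alternant I V e"
    by (simp add: alternant_def sum_negf)
  then have "2 * alternant I V e = 0"
    by (metis add.right_inverse mult_2)
  then show ?thesis using assms(6) by simp
qed

text \<open>Linearity of the determinant in column \<open>i\<close>.\<close>

lemma alternant_linear:
  assumes "finite I" "i \<in> I" "\<And>k. k \<in> I \<Longrightarrow> V k ^ e i = \<alpha> * V k ^ d + \<beta> * V k ^ d'"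
  shows "alternant I V e = \<alpha> * alternant I V (e(i := d)) + \<beta> * alternant I V (e(i := d'))"
proof -
  have "(\<Prod>k\<in>I. V (p k) ^ e k) =
      \<alpha> * (\<Prod>k\<in>I. V (p k) ^ (e(i := d)) k) + \<beta> * (\<Prod>k\<in>I. V (p k) ^ (e(i := d')) k)"
    if "p permutes I" for p
    using assms permutes_in_image[OF that]
    by (simp add: prod.remove[OF assms(1,2)] algebra_simps)
  then show ?thesis
    by (simp add: alternant_def sum_distrib_left sum.distrib algebra_simps)
qed

text \<open>Four distinct exponents sum to at least 6, so the sum is 7, which is only possible as 0
  + 1 + 2 + 4.\<close>

lemma exponents_are_4_2_1_0:
  assumes "inj_on e {1..4::nat}" "odd (\<Sum>k\<in>{1..4}. e k)" "(\<Sum>k\<in>{1..4}. e k) \<le> (8::nat)"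
  shows "\<exists>i j l. {i, j, l} \<subseteq> {1..4} \<and> e i = 4 \<and> e j = 2 \<and> e l = 1"
proof -
  let ?A = "e ` {1..4}"
  define xs where "xs = sorted_list_of_set ?A"
  have "length xs = 4"
    using card_image[OF assms(1)] by (simp add: xs_def)
  then obtain a b c d where xs: "xs = [a, b, c, d]"
    by (auto simp: numeral_eq_Suc length_Suc_conv)
  have "sorted_wrt (<) xs" "set xs = ?A"
    by (simp_all add: xs_def)
  then have lt: "a < b" "b < c" "c < d" and A: "?A = {a, b, c, d}"
    by (auto simp: xs)
  have "a + b + c + d = \<Sum> ?A"
    unfolding A using lt by simp
  also have "\<dots> = (\<Sum>k\<in>{1..4}. e k)"
    using sum.reindex[OF assms(1), of id] by simp
  finally have "a + b + c + d = (\<Sum>k\<in>{1..4}. e k)" .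
  then have s: "odd (a + b + c + d)" "a + b + c + d \<le> 8"
    using assms(2,3) by simp_all
  then have ab: "a = 0" "b = 1"
    using lt by linarith+
  then have "c = 2 \<and> (d = 3 \<or> d = 4 \<or> d = 5) \<or> c = 3 \<and> d = 4"
    using lt s by linarith
  then have "c = 2" "d = 4"
    using s(1) ab by auto
  then have "4 \<in> ?A" "2 \<in> ?A" "1 \<in> ?A"
    using A ab by auto
  then obtain i j l where "i \<in> {1..4}" "4 = e i" "j \<in> {1..4}" "2 = e j" "l \<in> {1..4}" "1 = e l"
    by (elim imageE)
  then have "{i, j, l} \<subseteq> {1..4} \<and> e i = 4 \<and> e j = 2 \<and> e l = 1" by simp
  then show ?thesis by blast
qed

text \<open>For distinct exponents, the column of fourth powers is a combination of the columns of
  squares and of first powers, which are both present; the determinant therefore vanishes.\<close>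

lemma alternant_four_eq_0:
  fixes x :: "'k::idom"
  assumes 2: "(2::'k) \<noteq> 0" and V: "V ` {1..4} \<subseteq> {1, x, - 1 - x, 0}"
    and e: "odd (\<Sum>k\<in>{1..4}. e k)" "(\<Sum>k\<in>{1..4}. e k) \<le> 8"
  shows "alternant {1..4::nat} V e = 0"
proof (cases "inj_on e {1..4}")
  case False
  then obtain i j where "i \<in> {1..4}" "j \<in> {1..4}" "i \<noteq> j" "e i = e j"
    by (auto simp: inj_on_def)
  then show ?thesis
    using alternant_eq_0_if_equal[of "{1..4}" i j e V] 2 by simp
next
  case True
  from exponents_are_4_2_1_0[OF True e] obtain i j l where ij: "i \<in> {1..4}" "j \<in> {1..4}" "l \<in> {1..4}"
    "e i = 4" "e j = 2" "e l = 1" by auto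
  \<comment> \<open>The values of \<open>V\<close> are roots of \<open>z (z - 1) (z - x) (z + 1 + x)\<close>, which has no \<open>z^3\<close> term.\<close>
  have "V k ^ e i = (1 + x + x\<^sup>2) * V k ^ 2 + (- x - x\<^sup>2) * V k ^ 1" if "k \<in> {1..4}" for k
  proof -
    have "V k \<in> {1, x, - 1 - x, 0}" using V that by blast
    moreover have "(- 1 - x)^4 = (1 + x + x\<^sup>2) * (- 1 - x)\<^sup>2 + (- x - x\<^sup>2) * (- 1 - x)"
      by (simp add: power2_eq_square power4_eq_xxxx algebra_simps)
    moreover have "x^4 = (1 + x + x\<^sup>2) * x\<^sup>2 + (- x - x\<^sup>2) * x"
      by (simp add: power2_eq_square power4_eq_xxxx algebra_simps)
    moreover have "1^4 = (1 + x + x\<^sup>2) * 1\<^sup>2 + (- x - x\<^sup>2) * 1"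
      "0^4 = (1 + x + x\<^sup>2) * 0\<^sup>2 + (- x - x\<^sup>2) * 0"
      by simp_all
    ultimately show ?thesis
      unfolding ij(4) power_one_right by (elim insertE emptyE) (simp_all only:)
  qed
  from alternant_linear[where V = V and e = e and d = 2 and d' = 1, OF _ ij(1) this]
  have "alternant {1..4} V e =
    (1 + x + x\<^sup>2) * alternant {1..4} V (e(i := 2)) + (- x - x\<^sup>2) * alternant {1..4} V (e(i := 1))"
    by simp
  moreover have "alternant {1..4} V (e(i := 2)) = 0"
    by (rule alternant_eq_0_if_equal[of _ i j]) (use ij 2 in auto)
  moreover have "alternant {1..4} V (e(i := 1)) = 0"
    by (rule alternant_eq_0_if_equal[of _ i l]) (use ij 2 in auto)
  ultimately show ?thesis by simp
qed

text \<open>Matrix indices start at 0, whereas \<open>sym_group 4\<close> permutes \<open>{1..4}\<close>.\<close>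

definition sign_rep :: "(nat \<Rightarrow> nat) \<Rightarrow> 'k::field mat" where
  "sign_rep p = mat 4 4 (\<lambda>(i, j). if Suc i = p (Suc j) then of_int (sign p) else 0)"

lemma sign_rep_mult_vec:
  fixes v :: "'k::field vec"
  assumes p: "p permutes {1..4}" and v: "v \<in> carrier_vec 4" and i: "i < 4"
  shows "(sign_rep p *\<^sub>v v) $ i = of_int (sign p) * v $ (inv' p (Suc i) - 1)"
proof -
  have "inv' p permutes {1..4}" using p by (rule permutes_inv)
  then have r: "inv' p (Suc i) \<in> {1..4}" using i permutes_in_image[of "inv' p" "{1..4}" "Suc i"] by simp
  have eq: "Suc i = p (Suc j) \<longleftrightarrow> j = inv' p (Suc i) - 1" for j
  proof -
    have "Suc i = p (Suc j) \<longleftrightarrow> inv' p (Suc i) = Suc j"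
      using permutes_inv_eq[OF p] by (simp only: eq_commute)
    then show ?thesis using r by (cases "inv' p (Suc i)") auto
  qed
  have "(sign_rep p *\<^sub>v v) $ i = (\<Sum>j<4. (if Suc i = p (Suc j) then of_int (sign p) else 0) * v $ j)"
    using v i by (simp add: sign_rep_def scalar_prod_def lessThan_atLeast0)
  also have "\<dots> = (\<Sum>j<4. if j = inv' p (Suc i) - 1 then of_int (sign p) * v $ j else 0)"
    unfolding eq by (intro sum.cong) auto
  also have "\<dots> = of_int (sign p) * v $ (inv' p (Suc i) - 1)"
  proof -
    have "inv' p (Suc i) - 1 < 4" using r by auto
    then show ?thesis by simp
  qed
  finally show ?thesis .
qed

lemma KG_module_sign_rep: "KG_module (sym_group 4) 4 sign_rep"
  unfolding KG_module_def
proof (intro conjI ballI)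
  show "sign_rep p \<in> carrier_mat 4 4" for p
    by (simp add: sign_rep_def)
  show "sign_rep \<one>\<^bsub>sym_group 4\<^esub> = 1\<^sub>m 4"
    by (rule eq_matI) (simp_all add: sign_rep_def sym_group_one)
  fix p q assume "p \<in> carrier (sym_group 4)" "q \<in> carrier (sym_group 4)"
  then have pq: "p permutes {1..4}" "q permutes {1..4}" by (simp_all add: sym_group_carrier)
  then have perm: "permutation p" "permutation q"
    using permutation_permutes by blast+
  have "sign_rep (p \<circ> q) = (sign_rep p * sign_rep q :: 'a mat)"
  proof (rule eq_matI)
    fix i k assume "i < dim_row (sign_rep p * sign_rep q)" "k < dim_col (sign_rep p * sign_rep q)"
    then have ik: "i < 4" "k < 4" by (simp_all add: sign_rep_def)
    have qk: "q (Suc k) \<in> {1..4}" using permutes_in_image[OF pq(2), of "Suc k"] ik by simp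
    then have qk': "q (Suc k) - 1 < 4" by auto
    have "(sign_rep p * sign_rep q :: 'a mat) $$ (i, k) = (\<Sum>j<4.
        (if Suc i = p (Suc j) then of_int (sign p) else 0) *
        (if Suc j = q (Suc k) then of_int (sign q) else 0))"
      using ik by (simp add: sign_rep_def scalar_prod_def lessThan_atLeast0)
    also have "\<dots> = (\<Sum>j<4. if j = q (Suc k) - 1 then
        (if Suc i = p (q (Suc k)) then of_int (sign p * sign q) else 0) else 0)"
      using qk by (intro sum.cong) auto
    also have "\<dots> = (if Suc i = p (q (Suc k)) then of_int (sign p * sign q) else 0)"
      using qk' by (simp add: sum.delta)
    also have "\<dots> = (sign_rep (p \<circ> q) :: 'a mat) $$ (i, k)"
      using ik perm by (simp add: sign_rep_def sign_compose)
    finally show "(sign_rep (p \<circ> q) :: 'a mat) $$ (i, k) = (sign_rep p * sign_rep q) $$ (i, k)" by simp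
  qed (simp_all add: sign_rep_def)
  then show "sign_rep (p \<otimes>\<^bsub>sym_group 4\<^esub> q) = (sign_rep p * sign_rep q :: 'a mat)"
    by (simp add: sym_group_mult)
qed

section \<open>The test vector and its negative\<close>

definition test_vec :: "'k::field \<Rightarrow> 'k vec" where
  "test_vec x = vec_of_list [1, x, - 1 - x, 0]"

lemma test_vec_closed [simp]: "test_vec x \<in> carrier_vec 4"
  unfolding test_vec_def by (rule carrier_vecI) (simp only: dim_vec_of_list, simp)

lemma test_vec_values: "k < 4 \<Longrightarrow> test_vec x $ k \<in> {1, x, - 1 - x, 0}"
proof -
  assume "k < 4"
  then have "k < length [1, x, - 1 - x, 0]"
    by simp
  then have "[1, x, - 1 - x, 0] ! k \<in> set [1, x, - 1 - x, 0]"
    by (rule nth_mem)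
  then show ?thesis
    by (simp only: test_vec_def vec_of_list_index list.set)
qed

text \<open>In even degree the scalar \<open>- 1\<close> disappears. In odd degree the sign of the
  permutation survives, the sum over the group is an alternant, and both sides are 0.\<close>

lemma sum_monomial_neg_test_vec:
  fixes x :: "'k::field"
  assumes 2: "(2::'k) \<noteq> 0" and m: "Poly_Mapping.keys m \<subseteq> {..<4}" and deg: "monom_degree m \<le> 8"
  defines "ev \<equiv> \<lambda>u :: 'k vec. \<Prod>i \<in> Poly_Mapping.keys m. u $ i ^ Poly_Mapping.lookup m i"
  shows "(\<Sum>g\<in>carrier (sym_group 4). ev (sign_rep g *\<^sub>v test_vec x)) =
    (\<Sum>g\<in>carrier (sym_group 4). ev (sign_rep g *\<^sub>v (- test_vec x)))"
proof -
  define V where "V k = test_vec x $ (k - 1)" for k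
  define e where "e k = Poly_Mapping.lookup m (k - 1)" for k
  have shift: "(\<Prod>i<4. F i) = (\<Prod>k\<in>{1..4}. F (k - 1))" for F :: "nat \<Rightarrow> 'k"
    by (rule prod.reindex_bij_witness[of _ "\<lambda>k. k - 1" Suc]) auto
  have ev4: "ev u = (\<Prod>k\<in>{1..4}. u $ (k - 1) ^ e k)" for u
  proof -
    have "ev u = (\<Prod>i<4. u $ i ^ Poly_Mapping.lookup m i)"
      unfolding ev_def by (rule prod.mono_neutral_left) (use m in \<open>auto simp: in_keys_iff\<close>)
    then show ?thesis
      by (simp only: shift e_def)
  qed
  have deg_e: "monom_degree m = (\<Sum>k\<in>{1..4}. e k)"
    unfolding monom_degree_superset[OF _ m, simplified] e_def
    by (rule sum.reindex_bij_witness[of _ "\<lambda>k. k - 1" Suc]) auto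
  \<comment> \<open>The scalar \<open>s\<close> treats the test vector (\<open>s = 1\<close>) and
    its negative (\<open>s = - 1\<close>) together.\<close>
  have eval: "ev (sign_rep p *\<^sub>v (s \<cdot>\<^sub>v test_vec x)) =
      (s * of_int (sign p)) ^ monom_degree m * (\<Prod>k\<in>{1..4}. V (inv' p k) ^ e k)"
    if p: "p permutes {1..4}" for p and s :: 'k
  proof -
    have "ev (sign_rep p *\<^sub>v (s \<cdot>\<^sub>v test_vec x)) =
        (\<Prod>k\<in>{1..4}. (s * of_int (sign p) * V (inv' p k)) ^ e k)"
      unfolding ev4
    proof (rule prod.cong[OF refl])
      fix k :: nat assume k: "k \<in> {1..4}"
      have "inv' p k \<in> {1..4}" using permutes_in_image[OF permutes_inv[OF p]] k by blast
      then have "inv' p k - 1 < 4" "k - 1 < 4" "Suc (k - 1) = k" using k by auto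
      then show "(sign_rep p *\<^sub>v (s \<cdot>\<^sub>v test_vec x)) $ (k - 1) ^ e k = (s * of_int (sign p) * V (inv' p k)) ^ e k"
        using sign_rep_mult_vec[OF p, of "s \<cdot>\<^sub>v test_vec x" "k - 1"] carrier_vecD[OF test_vec_closed[of x]]
        by (simp add: V_def mult_ac)
    qed
    then show ?thesis
      by (simp add: power_mult_distrib prod.distrib power_sum deg_e)
  qed
  have sum_eval: "(\<Sum>g\<in>carrier (sym_group 4). ev (sign_rep g *\<^sub>v (s \<cdot>\<^sub>v test_vec x))) =
      s ^ monom_degree m * (\<Sum>p | p permutes {1..4}. of_int (sign p) ^ monom_degree m * (\<Prod>k\<in>{1..4}. V (p k) ^ e k))"
    for s :: 'k
  proof -
    have "(\<Sum>g\<in>carrier (sym_group 4). ev (sign_rep g *\<^sub>v (s \<cdot>\<^sub>v test_vec x))) =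
        (\<Sum>p | p permutes {1..4}. (s * of_int (sign p)) ^ monom_degree m * (\<Prod>k\<in>{1..4}. V (inv' p k) ^ e k))"
      by (rule sum.cong) (auto simp: sym_group_def eval)
    \<comment> \<open>Summing over inverses removes \<open>inv'\<close>, as a permutation and its
      inverse have the same sign.\<close>
    also have "\<dots> = (\<Sum>p | p permutes {1..4}. (s * of_int (sign p)) ^ monom_degree m * (\<Prod>k\<in>{1..4}. V (p k) ^ e k))"
    proof (rule sum.reindex_bij_witness[of _ "inv'" "inv'"])
      fix p :: "nat \<Rightarrow> nat" assume "p \<in> {p. p permutes {1..4}}"
      then have p: "p permutes {1..4}" by simp
      show "inv' (inv' p) = p" "inv' (inv' p) = p" "inv' p \<in> {p. p permutes {1..4}}" "inv' p \<in> {p. p permutes {1..4}}"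
        using p permutes_inv_inv permutes_inv by auto
      have "permutation p" using p permutation_permutes by blast
      then show "(s * of_int (sign (inv' p))) ^ monom_degree m * (\<Prod>k\<in>{1..4}. V (inv' p k) ^ e k) =
          (s * of_int (sign p)) ^ monom_degree m * (\<Prod>k\<in>{1..4}. V (inv' p k) ^ e k)"
        by (simp add: sign_inverse)
    qed
    finally show ?thesis
      by (simp add: power_mult_distrib sum_distrib_left mult_ac)
  qed
  have neg: "- test_vec x = - 1 \<cdot>\<^sub>v test_vec x"
    by (rule eq_vecI) simp_all
  show ?thesis
  proof (cases "even (monom_degree m)")
    case True
    then show ?thesis
      using sum_eval[of 1] sum_eval[of "- 1"] by (simp add: neg)
  next
    case False
    have "V ` {1..4} \<subseteq> {1, x, - 1 - x, 0}"
    proof (rule image_subsetI)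
      fix k :: nat assume "k \<in> {1..4}"
      then have "k - 1 < 4" by auto
      then show "V k \<in> {1, x, - 1 - x, 0}"
        unfolding V_def by (rule test_vec_values)
    qed
    then have "alternant {1..4} V e = 0"
      by (rule alternant_four_eq_0[OF 2]) (use deg False deg_e in simp_all)
    moreover have "(of_int (sign p) :: 'k) ^ monom_degree m = of_int (sign p)" for p :: "nat \<Rightarrow> nat"
      using False by (cases p rule: sign_cases) simp_all
    ultimately show ?thesis
      using sum_eval[of 1] sum_eval[of "- 1"] by (simp add: alternant_def neg)
  qed
qed

text \<open>An invariant is constant on orbits, so 24 times its value is its sum over the group;
  this sum splits into the monomial sums treated above, and 24 can be cancelled.\<close>

lemma eval_neg_test_vec:
  fixes x :: "'k::field" and f :: "'k mpoly"
  assumes char: "(2::'k) \<noteq> 0" "(3::'k) \<noteq> 0"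
    and f: "f \<in> KG_invariants (sym_group 4) 4 sign_rep" "total_degree f \<le> 8"
  shows "mpoly_eval f (test_vec x) = mpoly_eval f (- test_vec x)"
proof -
  let ?G = "sym_group 4"
  note G = sym_group_is_group[of 4]
  interpret group ?G by (rule G)
  have fc: "f \<in> mpoly_carrier 4" and inv: "\<And>g. g \<in> carrier ?G \<Longrightarrow> KG_act ?G 4 sign_rep g f = f"
    using f(1) by (auto simp: KG_invariants_def)
  then have f8: "f \<in> mpolys 4 8" using f(2) by (simp add: mpolys_eq)
  have c24: "card (carrier ?G) = 24"
    by (simp add: sym_group_def card_permutations eval_nat_numeral)
  have eq: "24 * mpoly_eval f v = (\<Sum>m \<in> Poly_Mapping.keys f. Poly_Mapping.lookup f m *
      (\<Sum>g\<in>carrier ?G. \<Prod>i \<in> Poly_Mapping.keys m. (sign_rep g *\<^sub>v v) $ i ^ Poly_Mapping.lookup m i))"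
    if v: "v \<in> carrier_vec 4" for v :: "'k vec"
  proof -
    have "mpoly_eval f (sign_rep g *\<^sub>v v) = mpoly_eval f v" if g: "g \<in> carrier ?G" for g
      using mpoly_eval_KG_act[OF G KG_module_sign_rep inv_closed[OF g] fc v]
      unfolding inv_inv[OF g] inv[OF inv_closed[OF g]] by simp
    then have "24 * mpoly_eval f v = (\<Sum>g\<in>carrier ?G. mpoly_eval f (sign_rep g *\<^sub>v v))"
      using c24 by simp
    also have "\<dots> = (\<Sum>m \<in> Poly_Mapping.keys f. \<Sum>g\<in>carrier ?G. Poly_Mapping.lookup f m *
      (\<Prod>i \<in> Poly_Mapping.keys m. (sign_rep g *\<^sub>v v) $ i ^ Poly_Mapping.lookup m i))"
      unfolding mpoly_eval_def mpoly_insert_def by (rule sum.swap)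
    finally show ?thesis by (simp add: sum_distrib_left)
  qed
  have "24 * mpoly_eval f (test_vec x) = 24 * mpoly_eval f (- test_vec x)"
    unfolding eq[OF test_vec_closed] eq[OF uminus_carrier_vec[THEN iffD2, OF test_vec_closed]]
    using f8 char by (intro sum.cong refl arg_cong2[of _ _ _ _ "(*)"] sum_monomial_neg_test_vec)
      (auto simp: mpolys_def)
  moreover have "(24::'k) = 2 * 2 * 2 * 3" by simp
  then have "(24::'k) \<noteq> 0" using char by (metis mult_eq_0_iff)
  ultimately show ?thesis by simp
qed

text \<open>The conditions on \<open>x\<close> make the four entries distinct and keep
  \<open>- 1\<close> from being one of them. An even permutation would need \<open>- 1\<close> as an
  entry. An odd one would have to preserve all entries, hence be the identity, which is
  even.\<close>

lemma neg_test_vec_not_in_orbit: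
  fixes x :: "'k::field"
  assumes "(2::'k) \<noteq> 0" "x \<noteq> 0" "x \<noteq> 1" "x \<noteq> - 1" "x \<noteq> - 2" "2 * x \<noteq> - 1"
  shows "- test_vec x \<notin> KG_orbit (sym_group 4) sign_rep (test_vec x)"
proof
  assume "- test_vec x \<in> KG_orbit (sym_group 4) sign_rep (test_vec x)"
  then obtain p where p: "p permutes {1..4}" and eq: "- test_vec x = sign_rep p *\<^sub>v test_vec x"
    by (auto simp: KG_orbit_def sym_group_carrier)
  define V where "V k = test_vec x $ (k - 1)" for k
  have I: "{1..4::nat} = {1, 2, 3, 4}" by auto
  have V: "V 1 = 1" "V 2 = x" "V 3 = - 1 - x" "V 4 = 0"
    by (simp_all add: V_def test_vec_def eval_nat_numeral)
  have q: "inv' p permutes {1..4}" using p by (rule permutes_inv)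
  have *: "- V k = of_int (sign p) * V (inv' p k)" if "k \<in> {1..4}" for k
  proof -
    have "k - 1 < 4" "Suc (k - 1) = k" using that by auto
    then show ?thesis
      using sign_rep_mult_vec[OF p test_vec_closed, of "k - 1" x] carrier_vecD[OF test_vec_closed[of x]]
      by (simp add: V_def eq[symmetric])
  qed
  have inj: "inj_on V {1..4}"
  proof -
    have "- 1 - x \<noteq> 0" "- 1 - x \<noteq> 1"
      using assms by (auto simp: algebra_simps eq_neg_iff_add_eq_0)
    moreover have "- 1 - x \<noteq> x"
    proof
      assume "- 1 - x = x"
      then have "- 1 = x + x" by (simp only: diff_eq_eq)
      then have "2 * x = - 1" by (simp only: mult_2)
      with assms(6) show False by contradiction
    qed
    ultimately have "distinct (map V [1, 2, 3, 4])"
      using assms(2,3) V by auto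
    then show ?thesis unfolding I distinct_map by simp
  qed
  consider "sign p = 1" | "sign p = - 1"
    by (cases p rule: sign_cases)
  then show False
  proof cases
    case 1
    have "- 1 = V (inv' p 1)" using *[of 1] 1 V by simp
    moreover have "inv' p 1 \<in> {1..4}" using permutes_in_image[OF q, of 1] by simp
    then have "V (inv' p 1) \<in> {1, x, - 1 - x, 0}"
      unfolding I using V by auto
    ultimately have "- 1 \<in> {1, x, - 1 - x, 0}" by metis
    moreover have "- 1 \<noteq> (1::'k)" using assms(1) by (simp add: neg_eq_iff_add_eq_0)
    moreover have "- 1 \<noteq> - 1 - x" "- 1 \<noteq> x" "- 1 \<noteq> (0::'k)" using assms(2,4) by auto
    ultimately show False by blast
  next
    case 2
    have fix_k: "inv' p k = k" if k: "k \<in> {1..4}" for k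
    proof -
      have "V (inv' p k) = V k" using *[OF k] 2 by simp
      moreover have "inv' p k \<in> {1..4}" using permutes_in_image[OF q] k by blast
      ultimately show ?thesis using inj_onD[OF inj] k by blast
    qed
    have "inv' p = id"
    proof
      show "inv' p k = id k" for k
        using fix_k permutes_not_in[OF q] by (cases "k \<in> {1..4}") simp_all
    qed
    then have "p = id"
      using permutes_inv_inv[OF p] by simp
    then show False using 2 by simp
  qed
qed

text \<open>The value 2 works unless \<open>5 = 0\<close>. In that case the excluded values are
  exactly the elements of the prime field, where \<open>- 1 / 2\<close> is 2. Its nonzero elements
  satisfy \<open>z ^ 4 = 1\<close>, so an element of order 24 lies outside it.\<close>

lemma exists_test_value:
  assumes "(2::'k::field) \<noteq> 0" "(3::'k) \<noteq> 0" "(\<exists>x::'k. has_mult_order x 24) \<or> (5::'k) \<noteq> 0"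
  shows "\<exists>x::'k. x \<noteq> 0 \<and> x \<noteq> 1 \<and> x \<noteq> - 1 \<and> x \<noteq> - 2 \<and> 2 * x \<noteq> - 1"
proof (cases "(5::'k) = 0")
  case False
  have "(2::'k) + 2 = 2 * 2" by simp
  then have "(2::'k) + 2 \<noteq> 0" using assms(1) by (metis mult_eq_0_iff)
  moreover have "(2::'k) \<noteq> 1"
    by (metis add_cancel_right_right one_add_one one_neq_zero)
  ultimately show ?thesis
    using False assms by (intro exI[of _ 2]) (auto simp: eq_neg_iff_add_eq_0)
next
  case True
  then obtain z :: 'k where z: "has_mult_order z 24" using assms(3) by blast
  then have z24: "z ^ 24 = 1" "z ^ 4 \<noteq> 1" by (auto simp: has_mult_order_def)
  have "(16::'k) = 1 + 3 * 5" by simp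
  then have 16: "(16::'k) = 1" unfolding True by simp
  have "z \<noteq> 2"
    using z24(2) 16 by auto
  moreover have "2 * z \<noteq> - 1"
  proof
    assume h: "2 * z = - 1"
    have "z - 2 = 5 * z + 2 * (- 1 - 2 * z)" by (simp add: algebra_simps)
    then have "z = 2" unfolding True h by simp
    with \<open>z \<noteq> 2\<close> show False by simp
  qed
  ultimately show ?thesis
    using z24 16 by (intro exI[of _ z]) auto
qed

section \<open>Orbits, and the assembly of the two bounds\<close>

lemma KG_orbit_refl:
  assumes "KG_module G n \<rho>" "group G" "v \<in> carrier_vec n"
  shows "v \<in> KG_orbit G \<rho> v"
proof -
  interpret group G by fact
  have "v = \<rho> \<one>\<^bsub>G\<^esub> *\<^sub>v v"
    using assms(1,3) by (simp add: KG_module_def)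
  then show ?thesis
    unfolding KG_orbit_def using one_closed by blast
qed

lemma KG_orbit_subset:
  assumes "KG_module G n \<rho>" "group G" "v \<in> carrier_vec n" "w \<in> KG_orbit G \<rho> v"
  shows "KG_orbit G \<rho> w \<subseteq> KG_orbit G \<rho> v"
proof
  interpret group G by fact
  fix u assume "u \<in> KG_orbit G \<rho> w"
  then obtain g h where gh: "g \<in> carrier G" "h \<in> carrier G" "u = \<rho> g *\<^sub>v (\<rho> h *\<^sub>v v)"
    using assms(4) by (auto simp: KG_orbit_def)
  moreover have "\<rho> (g \<otimes>\<^bsub>G\<^esub> h) = \<rho> g * \<rho> h" "\<rho> g \<in> carrier_mat n n" "\<rho> h \<in> carrier_mat n n"
    using assms(1) gh by (simp_all add: KG_module_def)
  ultimately have "u = \<rho> (g \<otimes>\<^bsub>G\<^esub> h) *\<^sub>v v"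
    using assms(3) by simp
  then show "u \<in> KG_orbit G \<rho> v"
    using gh by (auto simp: KG_orbit_def)
qed

theorem theorem3p8:
  assumes "\<not> CHAR('k::field) dvd 24"
    and "(\<exists>x::'k. has_mult_order x 24) \<or> CHAR('k) \<noteq> 5"
  shows "beta_sep TYPE('k) (sym_group 4) = 9"
proof -
  let ?G = "sym_group 4"
  have char_dvd: "CHAR('k) dvd n" if "(of_nat n :: 'k) = 0" for n
    using that by (simp add: of_nat_eq_0_iff_char_dvd)
  have char: "(2::'k) \<noteq> 0" "(3::'k) \<noteq> 0"
    using char_dvd[of 2] char_dvd[of 3] assms(1) dvd_trans[of "CHAR('k)" 2 24] dvd_trans[of "CHAR('k)" 3 24]
    by auto
  have "(5::'k) \<noteq> 0" if "CHAR('k) \<noteq> 5"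
  proof
    assume "(5::'k) = 0"
    then have "CHAR('k) dvd 5" using char_dvd[of 5] by simp
    moreover have "prime (5::nat)" by simp
    \<comment> \<open>The value 1 is ruled out because it would divide 24.\<close>
    ultimately have "CHAR('k) = 1 \<or> CHAR('k) = 5" using prime_nat_iff by blast
    with that assms(1) show False by auto
  qed
  then obtain x :: 'k where x: "x \<noteq> 0" "x \<noteq> 1" "x \<noteq> - 1" "x \<noteq> - 2" "2 * x \<noteq> - 1"
    using exists_test_value[OF char] assms(2) by blast
  have "beta_sep_module ?G n \<rho> \<le> 9" if \<rho>: "KG_module ?G n \<rho>" for n and \<rho> :: "(nat \<Rightarrow> nat) \<Rightarrow> 'k mat"
  proof -
    have "separating_set ?G n \<rho> {f \<in> KG_invariants ?G n \<rho>. total_degree f \<le> 9}"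
      unfolding separating_set_def
    proof (intro conjI ballI impI)
      fix v w :: "'k vec"
      assume v: "v \<in> carrier_vec n" and w: "w \<in> carrier_vec n" and ne: "KG_orbit ?G \<rho> v \<noteq> KG_orbit ?G \<rho> w"
      show "\<exists>f\<in>{f \<in> KG_invariants ?G n \<rho>. total_degree f \<le> 9}. mpoly_eval f v \<noteq> mpoly_eval f w"
      proof (rule ccontr)
        assume "\<not> ?thesis"
        \<comment> \<open>Membership is obtained in both directions, so that the two orbits include
          each other.\<close>
        then have "w \<in> KG_orbit ?G \<rho> v" "v \<in> KG_orbit ?G \<rho> w"
          using separated_by_degree_9[OF \<rho> char v w] separated_by_degree_9[OF \<rho> char w v] by auto
        with KG_orbit_subset[OF \<rho> sym_group_is_group] v w ne show False by blast
      qed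
    qed auto
    then have "enat 9 \<in> {enat d | d. d > 0 \<and> separating_set ?G n \<rho> {f \<in> KG_invariants ?G n \<rho>. total_degree f \<le> d}}"
      by auto
    then have "beta_sep_module ?G n \<rho> \<le> enat 9"
      unfolding beta_sep_module_def by (rule Inf_lower)
    then show ?thesis by (simp add: numeral_eq_enat)
  qed
  \<comment> \<open>The module \<open>sign_rep\<close> needs degree 9, so the supremum is attained
    there.\<close>
  moreover have "9 \<le> beta_sep_module ?G 4 (sign_rep :: _ \<Rightarrow> 'k mat)"
    unfolding beta_sep_module_def
  proof (rule Inf_greatest, safe)
    fix d assume sep: "separating_set ?G 4 (sign_rep :: _ \<Rightarrow> 'k mat) {f \<in> KG_invariants ?G 4 sign_rep. total_degree f \<le> d}"
    have "- test_vec x \<in> KG_orbit ?G sign_rep (- test_vec x)"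
      by (rule KG_orbit_refl[OF KG_module_sign_rep sym_group_is_group]) simp
    with neg_test_vec_not_in_orbit[OF char(1) x]
    have "KG_orbit ?G sign_rep (test_vec x) \<noteq> KG_orbit ?G sign_rep (- test_vec x)" by blast
    with sep obtain f where "f \<in> KG_invariants ?G 4 sign_rep" "total_degree f \<le> d"
      "mpoly_eval f (test_vec x) \<noteq> mpoly_eval f (- test_vec x)"
      unfolding separating_set_def
      using test_vec_closed[of x] uminus_carrier_vec[of "test_vec x" 4] by blast
    with eval_neg_test_vec[OF char] have "\<not> d \<le> 8" by (meson order_trans)
    then show "9 \<le> enat d" by (simp add: numeral_eq_enat)
  qed
  ultimately show ?thesis
    unfolding beta_sep_def
    by (intro antisym Sup_least Sup_upper2[of "beta_sep_module ?G 4 (sign_rep :: _ \<Rightarrow> 'k mat)"])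
      (auto intro: KG_module_sign_rep)
qed

end
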